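(* Let $p$ be a prime, let $m \ge 2$ be an integer, and let $\delta>0$, $\nu>0$, $\epsilon>0$. Then there exists $c_{\omega}(\delta,\nu,\epsilon,p,m)>0$ such that the following holds. If $s$ is a positive integer and $\mathcal{A}_1,\dots,\mathcal{A}_s$ are non-empty subsets of $\{0,1\}^n$ each with density at least $\delta$ inside $\{0,1\}^n$, then there exists a subset $Q\subset[s]$ with $|Q|\ge c_{\omega}(\delta,\nu,\epsilon,p,m)\,s$ such that for at least $(1-\epsilon)|Q|^m$ of the $m$-tuples $(i_1,\dots,i_m)\in Q^m$ we have \[\omega_{\mathcal{A}_{i_1},\dots,\mathcal{A}_{i_m}}\phi \ge 2^{-(m+1)(p-1)}-\nu\] for every mod-$p$ form $\phi$.
   Context: A mod-$p$ form is a linear form $\phi:\mathbb{F}_p^n\to\mathbb{F}_p$, evaluated on $\{0,1\}^n$ by identifying $\{0,1\}$ with the elements $0,1$ of $\mathbb{F}_p$. The density of $\mathcal{A}\subset\{0,1\}^n$ is $|\mathcal{A}|/2^n$. For random variables $X_1,\dots,X_m$ taking values in a finite set $D$, the overlap is $\omega(X_1,\dots,X_m)=\sum_{d\in D}\min(\mathbb{P}[X_1=d],\dots,\mathbb{P}[X_m=d])$. For a function $F$ on $\{0,1\}^n$ and non-empty $\mathcal{A}_1,\dots,\mathcal{A}_m\subset\{0,1\}^n$, $\omega_{\mathcal{A}_1,\dots,\mathcal{A}_m}(F)$ denotes $\omega(X_1,\dots,X_m)$ where $X_i$ is distributed as $F(x)$ for $x$ uniform in $\mathcal{A}_i$. 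*)

theory Defs
  imports "HOL-Probability.Probability_Mass_Function" "HOL-Number_Theory.Residues"
begin

(* The field F_p is the residue ring with carrier {0..p - 1} of integers, so that for prime p the
   cube {0,1}^n is literally a subset of F_p^n. *)

abbreviation Fp :: "nat \<Rightarrow> int ring" where
  "Fp p \<equiv> residue_ring (int p)"

definition Fp_vec :: "nat \<Rightarrow> nat \<Rightarrow> (nat \<Rightarrow> int) set" where
  "Fp_vec p n = {1..n} \<rightarrow>\<^sub>E carrier (Fp p)"

definition cube :: "nat \<Rightarrow> (nat \<Rightarrow> int) set" where
  "cube n = {1..n} \<rightarrow>\<^sub>E {0, 1}"

definition mod_form :: "nat \<Rightarrow> nat \<Rightarrow> ((nat \<Rightarrow> int) \<Rightarrow> int) \<Rightarrow> bool" where
  "mod_form p n \<phi> \<longleftrightarrow>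
     \<phi> \<in> Fp_vec p n \<rightarrow> carrier (Fp p) \<and>
     (\<forall>x\<in>Fp_vec p n. \<forall>y\<in>Fp_vec p n.
        \<phi> (\<lambda>i\<in>{1..n}. x i \<oplus>\<^bsub>Fp p\<^esub> y i) = \<phi> x \<oplus>\<^bsub>Fp p\<^esub> \<phi> y) \<and>
     (\<forall>a\<in>carrier (Fp p). \<forall>x\<in>Fp_vec p n.
        \<phi> (\<lambda>i\<in>{1..n}. a \<otimes>\<^bsub>Fp p\<^esub> x i) = a \<otimes>\<^bsub>Fp p\<^esub> \<phi> x)"

definition cube_density :: "nat \<Rightarrow> (nat \<Rightarrow> int) set \<Rightarrow> real" where
  "cube_density n \<A> = real (card \<A>) / 2 ^ n"

(* The overlap depends only on the laws of the random variables; X j is the law of the j-th one. *)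

definition overlap :: "'d set \<Rightarrow> nat \<Rightarrow> (nat \<Rightarrow> 'd pmf) \<Rightarrow> real" where
  "overlap D m X = (\<Sum>d\<in>D. Min ((\<lambda>j. pmf (X j) d) ` {1..m}))"

definition overlap_on :: "'d set \<Rightarrow> nat \<Rightarrow> (nat \<Rightarrow> 'a set) \<Rightarrow> ('a \<Rightarrow> 'd) \<Rightarrow> real" where
  "overlap_on D m \<A> F = overlap D m (\<lambda>j. map_pmf F (pmf_of_set (\<A> j)))"

end

theory Submission
  imports Defs
begin

text \<open>
  A form is a coefficient vector, and two forms are close if they differ in few coordinates.
  By almost orthogonality of characters, the forms that are biased on a dense set are covered by a
  bounded number of balls. Hence one can pass to a positive proportion of the sets for which there is
  a bounded list \<open>V\<close> of forms such that, for almost all pairs of sets, every form biased on both is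
  close to \<open>V\<close>. A form biased on at most one set of a tuple is almost uniform on the others, so the
  overlap is at least about \<open>1 / p\<close>.

  It remains to treat \<open>v + \<psi>\<close> with \<open>v \<in> V\<close> and \<open>\<psi>\<close> of bounded support. An energy increment
  argument attaches to every set \<open>A i\<close> a bounded set \<open>J i\<close> of coordinates such that, given the values
  of \<open>V\<close> and the coordinates in \<open>J i\<close>, any boundedly many further coordinates are almost uniform on
  \<open>A i\<close>. After passing to a further positive proportion, almost all pairs \<open>J i\<close>, \<open>J j\<close> meet only in a
  common set \<open>J0\<close>, and \<open>V\<close> has almost the same joint law with the coordinates in \<open>J0\<close> on all sets.
  Given the values of \<open>V\<close> and \<open>J0\<close>, choose for each set of the tuple a popular value of the part of
  \<open>\<psi>\<close> supported on \<open>J i - J0\<close>. The sum of these values is a common target: on each set, its own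
  part is popular with probability at least \<open>1 / p\<close>, and the remaining part of \<open>\<psi>\<close> sees uniform bits,
  for which any attained value has probability at least \<open>1 / 2 ^ (p - 1)\<close> by a theorem of Olson.
\<close>

section \<open>Subset sums modulo p\<close>

lemma card_eq_sum_fibres:
  assumes "finite X" "finite C" "f ` X \<subseteq> C"
  shows "card X = (\<Sum>c\<in>C. card {x. x \<in> X \<and> f x = c})"
  using sum.group[OF assms, of "\<lambda>_. 1::nat"] by simp

text \<open>Pigeonhole: the \<open>p + 1\<close> prefix sums along an enumeration of
  \<open>S\<close> take at most \<open>p\<close> residues, so two coincide, and the block between
  them sums to zero modulo \<open>p\<close>.\<close>

lemma exists_zero_sum_subset:
  fixes a :: "'a \<Rightarrow> int"
  assumes "finite S" and "p > 0" and "p \<le> card S"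
  shows "\<exists>W\<subseteq>S. W \<noteq> {} \<and> int p dvd sum a W"
proof -
  obtain h where h: "bij_betw h {0..<card S} S"
    using ex_bij_betw_nat_finite[OF \<open>finite S\<close>] by blast
  define s where "s k = (\<Sum>i<k. a (h i)) mod int p" for k
  have "s ` {..p} \<subseteq> {0..<int p}"
    using \<open>p > 0\<close> by (auto simp: s_def)
  then have "card (s ` {..p}) \<le> card {0..<int p}"
    by (intro card_mono) auto
  then have "\<not> inj_on s {..p}"
    by (metis card_atMost card_image card_atLeastLessThan_int diff_zero nat_int not_less_eq_eq order_refl)
  then obtain k l where kl: "k < l" "l \<le> p" "s k = s l"
    unfolding inj_on_def by (metis atMost_iff nat_neq_iff)
  define W where "W = h ` {k..<l}"
  have inj: "inj_on h {k..<l}"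
    using bij_betw_imp_inj_on[OF h] kl assms(3) by (auto intro: inj_on_subset)
  have "W \<subseteq> S"
    using bij_betw_imp_surj_on[OF h] kl assms(3) unfolding W_def by auto
  moreover have "W \<noteq> {}"
    using kl by (auto simp: W_def)
  moreover have "int p dvd sum a W"
  proof -
    have "sum a W = (\<Sum>i\<in>{k..<l}. a (h i))"
      unfolding W_def by (simp add: sum.reindex[OF inj])
    also have "\<dots> = (\<Sum>i<l. a (h i)) - (\<Sum>i<k. a (h i))"
      using sum_diff_nat_ivl[of 0 k l "\<lambda>i. a (h i)"] kl by (simp add: lessThan_atLeast0)
    finally show ?thesis
      using kl(3) by (metis s_def mod_eq_dvd_iff)
  qed
  ultimately show ?thesis by blast
qed

text \<open>Olson's argument: if \<open>W\<close> is a zero-sum set containing \<open>g\<close>, then taking the symmetric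
  difference with \<open>W\<close> matches the zero-sum sets through \<open>g\<close> with the zero-sum sets avoiding \<open>g\<close>
  for the weights with signs flipped on \<open>W\<close>.\<close>

lemma card_zero_sum_subsets_ge:
  fixes a :: "'a \<Rightarrow> int"
  assumes "finite S" and "p > 0"
  shows "2 ^ card S \<le> 2 ^ (p - 1) * card {T. T \<subseteq> S \<and> int p dvd sum a T}"
  using assms(1)
proof (induction "card S" arbitrary: S a rule: less_induct)
  case less
  let ?Z = "\<lambda>a S. {T. T \<subseteq> S \<and> int p dvd sum a T}"
  have fin: "finite (?Z a S)" for a :: "'a \<Rightarrow> int"
    using less.prems by auto
  show ?case
  proof (cases "card S < p")
    case True
    \<comment> \<open>Below \<open>p\<close> elements the empty set alone gives the bound.\<close>
    then have "(2::nat) ^ card S \<le> 2 ^ (p - 1)"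
      by (intro power_increasing) auto
    moreover have "1 \<le> card (?Z a S)"
      using card_mono[OF fin[of a], of "{{}}"] by simp
    ultimately show ?thesis
      by (metis mult_le_mono mult.right_neutral)
  next
    case False
    then obtain W where W: "W \<subseteq> S" "W \<noteq> {}" "int p dvd sum a W"
      using exists_zero_sum_subset[of S p a] less.prems assms(2) by auto
    then obtain g where g: "g \<in> W" by auto
    define a' where "a' j = (if j \<in> W then - a j else a j)" for j
    let ?S = "S - {g}"
    define sd where "sd T = (T - W) \<union> (W - T)" for T
    have cardS: "card S = Suc (card ?S)"
      using g W(1) less.prems by (metis card_Suc_Diff1 subsetD)
    have IH: "2 ^ card ?S \<le> 2 ^ (p - 1) * card (?Z b ?S)" for b :: "'a \<Rightarrow> int"
      using less.hyps[of ?S b] less.prems cardS by auto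
    have inj: "inj_on sd (?Z a' ?S)"
      by (auto simp: inj_on_def sd_def)
    have sub: "sd ` ?Z a' ?S \<subseteq> ?Z a S - ?Z a ?S"
    proof
      fix U assume "U \<in> sd ` ?Z a' ?S"
      then obtain T where T: "T \<subseteq> ?S" "int p dvd sum a' T" "U = sd T" by auto
      have fT: "finite T" "finite W" using T(1) W(1) less.prems by (auto intro: finite_subset)
      have "sum a U = sum a (T - W) + sum a (W - T)"
        unfolding T(3) sd_def using fT by (intro sum.union_disjoint) auto
      moreover have "sum a (W - T) = sum a W - sum a (W \<inter> T)"
        using fT sum.Int_Diff[of W a T] by simp
      moreover have "sum a' T = sum a' (T \<inter> W) + sum a' (T - W)"
        using fT sum.Int_Diff[of T a' W] by simp
      moreover have "sum a' (T \<inter> W) = - sum a (W \<inter> T)"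
        by (simp add: a'_def sum_negf[symmetric] Int_commute)
      moreover have "sum a' (T - W) = sum a (T - W)"
        by (rule sum.cong) (auto simp: a'_def)
      ultimately have "sum a U = sum a' T + sum a W" by simp
      then have "int p dvd sum a U" using T(2) W(3) by simp
      moreover have "U \<subseteq> S" "g \<in> U"
        using T(1) W(1) g unfolding T(3) sd_def by auto
      ultimately show "U \<in> ?Z a S - ?Z a ?S" by auto
    qed
    have fin': "finite (?Z a ?S)"
      using less.prems by auto
    have "card (?Z a' ?S) \<le> card (?Z a S - ?Z a ?S)"
      using card_mono[OF _ sub] fin[of a] card_image[OF inj] by simp
    moreover have "card (?Z a S - ?Z a ?S) = card (?Z a S) - card (?Z a ?S)"
      using fin' by (intro card_Diff_subset) auto
    moreover have "card (?Z a ?S) \<le> card (?Z a S)"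
      using fin[of a] by (intro card_mono) auto
    \<comment> \<open>Both terms on the left are bounded below by the induction hypothesis on
      \<open>S - {g}\<close>, for the weights \<open>a'\<close> and \<open>a\<close>; together they
      give twice the bound for \<open>S - {g}\<close>.\<close>
    ultimately have "card (?Z a' ?S) + card (?Z a ?S) \<le> card (?Z a S)" by linarith
    then have "2 ^ (p - 1) * (card (?Z a' ?S) + card (?Z a ?S)) \<le> 2 ^ (p - 1) * card (?Z a S)"
      by simp
    with IH[of a] IH[of a'] show ?thesis
      unfolding cardS by (simp add: algebra_simps)
  qed
qed

text \<open>A 0/1 vector is encoded by the set \<open>T\<close> of coordinates where it departs from
  \<open>z0\<close>. Flipping coordinate \<open>j\<close> changes the sum by
  \<open>a j * (1 - 2 * z0 j)\<close>, so keeping the value at \<open>z0\<close> is a zero-sum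
  condition on \<open>T\<close>.\<close>

lemma card_attained_value_ge:
  fixes a z0 :: "'a \<Rightarrow> int"
  assumes "finite S" and "p > 0" and "\<And>j. j \<in> S \<Longrightarrow> z0 j \<in> {0, 1}"
  shows "2 ^ card S \<le> 2 ^ (p - 1) *
    card {z \<in> S \<rightarrow>\<^sub>E {0, 1}. [(\<Sum>j\<in>S. a j * z j) = (\<Sum>j\<in>S. a j * z0 j)] (mod int p)}"
    (is "_ \<le> _ * card ?R")
proof -
  define a' where "a' j = a j * (1 - 2 * z0 j)" for j
  define f where "f T = (\<lambda>j\<in>S. if j \<in> T then 1 - z0 j else z0 j)" for T
  let ?Z = "{T. T \<subseteq> S \<and> int p dvd sum a' T}"
  have "inj_on f ?Z"
  proof (rule inj_onI)
    fix T U assume TU: "T \<in> ?Z" "U \<in> ?Z" "f T = f U"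
    have "j \<in> T \<longleftrightarrow> j \<in> U" if "j \<in> S" for j
      using fun_cong[OF TU(3), of j] assms(3)[OF that] that
      by (elim insertE) (auto simp: f_def split: if_splits)
    then show "T = U" using TU by auto
  qed
  moreover have "f ` ?Z \<subseteq> ?R"
  proof
    fix z assume "z \<in> f ` ?Z"
    then obtain T where T: "T \<subseteq> S" "int p dvd sum a' T" "z = f T" by auto
    have "z \<in> S \<rightarrow>\<^sub>E {0, 1}"
      using assms(3) unfolding T(3) f_def by fastforce
    moreover have "(\<Sum>j\<in>S. a j * z j) - (\<Sum>j\<in>S. a j * z0 j) = (\<Sum>j\<in>S. if j \<in> T then a' j else 0)"
      unfolding sum_subtractf[symmetric]
      by (rule sum.cong) (auto simp: T(3) f_def a'_def algebra_simps)
    moreover have "\<dots> = sum a' T"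
      using T(1) assms(1) by (simp add: sum.If_cases Int_absorb1)
    ultimately show "z \<in> ?R"
      using T(2) by (simp add: cong_iff_dvd_diff)
  qed
  moreover have "finite ?R"
    using assms(1) by (auto intro!: finite_PiE)
  ultimately have "card ?Z \<le> card ?R"
    using card_inj_on_le by blast
  then have "2 ^ (p - 1) * card ?Z \<le> 2 ^ (p - 1) * card ?R" by simp
  then show ?thesis
    using card_zero_sum_subsets_ge[OF assms(1,2), of a'] by linarith
qed

section \<open>Characters of the cube\<close>

definition dot :: "nat \<Rightarrow> (nat \<Rightarrow> int) \<Rightarrow> (nat \<Rightarrow> int) \<Rightarrow> int" where
  "dot n a x = (\<Sum>j\<in>{1..n}. a j * x j)"

text \<open>Coefficients are integers read modulo \<open>p\<close>, so this is only a pseudometric: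
  distance zero means that two vectors define the same form.\<close>

definition hamming :: "nat \<Rightarrow> nat \<Rightarrow> (nat \<Rightarrow> int) \<Rightarrow> (nat \<Rightarrow> int) \<Rightarrow> nat" where
  "hamming p n a b = card {j \<in> {1..n}. \<not> int p dvd a j - b j}"

definition chr :: "nat \<Rightarrow> int \<Rightarrow> complex" where
  "chr p r = cis (2 * pi * real_of_int r / real p)"

text \<open>All non-zero multiples \<open>t\<close> are tested, because a law on the residues modulo
  \<open>p\<close> is close to uniform when every non-trivial character sum is small.\<close>

definition biased :: "nat \<Rightarrow> nat \<Rightarrow> real \<Rightarrow> (nat \<Rightarrow> int) set \<Rightarrow> (nat \<Rightarrow> int) \<Rightarrow> bool" where
  "biased p n \<eta> A a \<longleftrightarrow>
     (\<exists>t\<in>{1..<p}. norm (\<Sum>x\<in>A. chr p (int t * dot n a x)) > \<eta> * real (card A))"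

lemma finite_cube: "finite (cube n)"
  unfolding cube_def by (intro finite_PiE) auto

lemma card_cube: "card (cube n) = 2 ^ n"
  unfolding cube_def by (subst card_funcsetE) (auto simp: numeral_2_eq_2)

lemma hamming_refl: "hamming p n a a = 0"
  by (simp add: hamming_def)

lemma hamming_commute: "hamming p n a b = hamming p n b a"
  unfolding hamming_def by (simp only: dvd_diff_commute[of "int p" "a _" "b _"])

lemma hamming_triangle: "hamming p n a c \<le> hamming p n a b + hamming p n b c"
proof -
  let ?S = "\<lambda>a b. {j \<in> {1..n}. \<not> int p dvd a j - b j}"
  have "int p dvd a j - c j" if "int p dvd a j - b j" "int p dvd b j - c j" for j
    using dvd_add[OF that] by simp
  then have "?S a c \<subseteq> ?S a b \<union> ?S b c"
    by auto
  then have "card (?S a c) \<le> card (?S a b \<union> ?S b c)"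
    by (intro card_mono) auto
  also have "\<dots> \<le> card (?S a b) + card (?S b c)"
    by (rule card_Un_le)
  finally show ?thesis unfolding hamming_def .
qed

lemma chr_0 [simp]: "chr p 0 = 1"
  by (simp add: chr_def)

lemma chr_add: "chr p (r + s) = chr p r * chr p s"
  by (simp add: chr_def cis_mult ring_distribs add_divide_distrib)

lemma norm_chr [simp]: "norm (chr p r) = 1"
  by (simp add: chr_def)

lemma cnj_chr: "cnj (chr p r) = chr p (- r)"
  by (simp add: chr_def cis_cnj)

lemma chr_sum: "chr p (sum f S) = (\<Prod>j\<in>S. chr p (f j))"
  by (induction S rule: infinite_finite_induct) (auto simp: chr_add)

lemma chr_power: "chr p r ^ k = chr p (int k * r)"
  by (induction k) (auto simp: chr_add ring_distribs)

lemma Re_chr_eq_1_iff: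
  assumes "p > 0"
  shows "Re (chr p r) = 1 \<longleftrightarrow> int p dvd r"
proof
  assume "Re (chr p r) = 1"
  then have "cos (2 * pi * real_of_int r / real p) = 1"
    by (simp add: chr_def)
  then obtain k :: int where "2 * pi * real_of_int r / real p = real_of_int k * 2 * pi"
    using cos_one_2pi_int by blast
  then have "real_of_int r = real_of_int (k * int p)"
    using assms by (simp add: field_simps)
  then have "r = k * int p"
    using of_int_eq_iff by blast
  then show "int p dvd r" by simp
next
  assume "int p dvd r"
  then obtain k where "r = int p * k" by auto
  then have "2 * pi * real_of_int r / real p = 2 * pi * real_of_int k"
    using assms by simp
  then show "Re (chr p r) = 1"
    by (simp add: chr_def del: cis.simps)
qed

lemma chr_eq_1_iff:
  assumes "p > 0"
  shows "chr p r = 1 \<longleftrightarrow> int p dvd r"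
proof
  assume "int p dvd r"
  then have "Re (chr p r) = 1"
    using Re_chr_eq_1_iff[OF assms] by simp
  moreover have "(Re (chr p r))\<^sup>2 + (Im (chr p r))\<^sup>2 = 1"
    using norm_chr[of p r] by (simp add: cmod_def)
  ultimately show "chr p r = 1"
    by (simp add: complex_eq_iff)
next
  assume "chr p r = 1"
  then show "int p dvd r"
    using Re_chr_eq_1_iff[OF assms, of r] by simp
qed

lemma chr_cong:
  assumes "p > 0" and "int p dvd r - s"
  shows "chr p r = chr p s"
proof -
  have "chr p r = chr p (r - s) * chr p s"
    by (simp flip: chr_add)
  then show ?thesis
    using assms chr_eq_1_iff by simp
qed

lemma sum_chr_multiples:
  assumes "p > 0"
  shows "(\<Sum>t<p. chr p (int t * r)) = (if int p dvd r then of_nat p else 0)"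
proof (cases "int p dvd r")
  case True
  then have "chr p (int t * r) = 1" for t
    using chr_eq_1_iff[OF assms] by simp
  then show ?thesis using True by simp
next
  case False
  then have "chr p r \<noteq> 1"
    using chr_eq_1_iff[OF assms] by simp
  moreover have "chr p r ^ p = 1"
    using chr_eq_1_iff[OF assms] by (simp add: chr_power)
  ultimately have "(\<Sum>t<p. chr p r ^ t) = 0"
    by (simp add: geometric_sum)
  then show ?thesis
    using False by (simp add: chr_power)
qed

text \<open>The coordinates of a cube point vary independently, so the character sum
  factorises.\<close>

lemma sum_chr_cube:
  "(\<Sum>x\<in>cube n. chr p (dot n a x)) = (\<Prod>j\<in>{1..n}. 1 + chr p (a j))"
proof -
  have "(\<Prod>j\<in>{1..n}. 1 + chr p (a j)) = (\<Prod>j\<in>{1..n}. \<Sum>y\<in>{0, 1}. chr p (a j * y))"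
    by simp
  also have "\<dots> = (\<Sum>x\<in>cube n. \<Prod>j\<in>{1..n}. chr p (a j * x j))"
    unfolding cube_def by (rule prod_sum_PiE) auto
  finally show ?thesis
    by (simp add: dot_def chr_sum)
qed

text \<open>Only the residue of \<open>r\<close> matters, so a maximum of finitely many numbers
  below one suffices, and \<open>\<rho>\<close> depends on \<open>p\<close> alone. The extra element
  \<open>1/2\<close> of \<open>B\<close> keeps that maximum positive.\<close>

lemma norm_one_plus_chr_bound:
  assumes "p > 0"
  shows "\<exists>\<rho>. 0 < \<rho> \<and> \<rho> < 1 \<and> (\<forall>r. \<not> int p dvd r \<longrightarrow> norm (1 + chr p r) \<le> 2 * \<rho>)"
proof -
  define B where "B = insert (1/2) ((\<lambda>r. norm (1 + chr p r) / 2) ` {1..<int p})"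
  have fin: "finite B" and ne: "B \<noteq> {}" by (auto simp: B_def)
  have lt: "norm (1 + chr p r) / 2 < 1" if "\<not> int p dvd r" for r
  proof -
    have R: "Re (chr p r) \<noteq> 1" "Re (chr p r) \<le> 1"
      using that Re_chr_eq_1_iff[OF assms] complex_Re_le_cmod[of "chr p r"] by auto
    have "(Re (chr p r))\<^sup>2 + (Im (chr p r))\<^sup>2 = 1"
      using norm_chr[of p r] by (simp add: cmod_def)
    then have "(norm (1 + chr p r))\<^sup>2 = 2 + 2 * Re (chr p r)"
      by (simp add: cmod_power2 power2_sum)
    then have "(norm (1 + chr p r))\<^sup>2 < 2\<^sup>2" using R by simp
    then have "norm (1 + chr p r) < 2"
      by (rule power_less_imp_less_base) simp
    then show ?thesis by simp
  qed
  have B1: "b < 1" if "b \<in> B" for b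
    using that lt by (auto simp: B_def zdvd_not_zless)
  have "Max B < 1" using fin ne B1 by simp
  moreover have "0 < Max B"
    using Max_ge[OF fin, of "1/2"] by (simp add: B_def)
  moreover have "norm (1 + chr p r) \<le> 2 * Max B" if "\<not> int p dvd r" for r
  proof -
    have "chr p r = chr p (r mod int p)"
      using assms by (intro chr_cong) (auto simp: minus_mod_eq_mult_div)
    moreover have "r mod int p \<in> {1..<int p}"
    proof -
      have "0 \<le> r mod int p" "r mod int p < int p" "r mod int p \<noteq> 0"
        using that assms by (auto simp: dvd_eq_mod_eq_0)
      then show ?thesis by simp
    qed
    ultimately have "norm (1 + chr p r) / 2 \<in> B"
      unfolding B_def by auto
    then show ?thesis using Max_ge[OF fin] by fastforce
  qed
  ultimately show ?thesis by blast
qed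

text \<open>In the product formula each coefficient that is non-zero modulo \<open>p\<close> gives a
  factor of at most \<open>2 * \<rho>\<close>, any other a factor of at most 2.\<close>

lemma norm_sum_chr_cube_le:
  assumes "0 < \<rho>" "\<rho> < 1" and "\<And>r. \<not> int p dvd r \<Longrightarrow> norm (1 + chr p r) \<le> 2 * \<rho>"
    and "D \<le> card {j \<in> {1..n}. \<not> int p dvd a j}"
  shows "norm (\<Sum>x\<in>cube n. chr p (dot n a x)) \<le> 2 ^ n * \<rho> ^ D"
proof -
  let ?S = "{j \<in> {1..n}. \<not> int p dvd a j}"
  have le2: "norm (1 + chr p r) \<le> 2" for r
    using norm_triangle_ineq[of 1 "chr p r"] by simp
  have "norm (\<Sum>x\<in>cube n. chr p (dot n a x)) = (\<Prod>j\<in>{1..n}. norm (1 + chr p (a j)))"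
    unfolding sum_chr_cube by (simp add: prod_norm)
  also have "\<dots> \<le> (\<Prod>j\<in>{1..n}. 2 * (if \<not> int p dvd a j then \<rho> else 1))"
    using assms(3) le2 by (intro prod_mono) auto
  also have "\<dots> = 2 ^ n * (\<Prod>j\<in>{1..n}. if \<not> int p dvd a j then \<rho> else 1)"
    by (simp only: prod.distrib) simp
  also have "(\<Prod>j\<in>{1..n}. if \<not> int p dvd a j then \<rho> else 1) = (\<Prod>j\<in>?S. \<rho>)"
    by (rule prod.inter_filter[symmetric]) simp
  also have "\<dots> = \<rho> ^ card ?S" by simp
  also have "2 ^ n * \<rho> ^ card ?S \<le> 2 ^ n * \<rho> ^ D"
    using assms by (intro mult_left_mono power_decreasing) auto
  finally show ?thesis .
qed

text \<open>A Bessel inequality for the almost orthogonal characters \<open>chr p (dot n (c i) x)\<close>.\<close>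

lemma card_biased_characters_le:
  fixes c :: "'i \<Rightarrow> nat \<Rightarrow> int" and \<eta> \<delta> :: real
  assumes "finite I" and "A \<subseteq> cube n" and "A \<noteq> {}" and "real (card A) \<ge> \<delta> * 2 ^ n"
    and "\<delta> > 0" "\<eta> > 0"
    and big: "\<And>i. i \<in> I \<Longrightarrow> norm (\<Sum>x\<in>A. chr p (dot n (c i) x)) \<ge> \<eta> * real (card A)"
    and orth: "\<And>i j. i \<in> I \<Longrightarrow> j \<in> I \<Longrightarrow> i \<noteq> j \<Longrightarrow>
      norm (\<Sum>x\<in>cube n. chr p (dot n (\<lambda>k. c i k - c j k) x)) \<le> 2 ^ n * (\<delta> * \<eta>\<^sup>2 / 2)"
  shows "real (card I) \<le> 2 / (\<delta> * \<eta>\<^sup>2)"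
proof (cases "I = {}")
  case True
  then show ?thesis using assms by simp
next
  case False
  let ?K = "real (card I)" and ?\<tau> = "\<delta> * \<eta>\<^sup>2 / 2"
  have K: "?K > 0" using False assms(1) by (simp add: card_gt_0_iff)
  have finA: "finite A" using assms(2) finite_cube finite_subset by blast
  then have A: "real (card A) > 0" using assms(3) by (simp add: card_gt_0_iff)
  define s where "s i = (\<Sum>x\<in>A. chr p (dot n (c i) x))" for i
  \<comment> \<open>The phases \<open>u i\<close> rotate every sum \<open>s i\<close> to its
    absolute value, so the sum of the one function \<open>G\<close> over \<open>A\<close> collects
    the contributions of all characters.\<close>
  define u where "u i = cnj (sgn (s i))" for i
  define G where "G x = (\<Sum>i\<in>I. u i * chr p (dot n (c i) x))" for x
  have us: "u i * s i = of_real (norm (s i))" for i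
  proof -
    have "s i * cnj (s i) = of_real ((norm (s i))\<^sup>2)"
      by (metis complex_norm_square of_real_power)
    then show ?thesis
      by (cases "s i = 0")
         (auto simp: u_def sgn_div_norm scaleR_conv_of_real power2_eq_square field_simps)
  qed
  have u1: "norm (u i) \<le> 1" for i
    by (simp add: u_def norm_sgn)
  have "?K * (\<eta> * card A) = (\<Sum>i\<in>I. \<eta> * real (card A))" by simp
  also have "\<dots> \<le> (\<Sum>i\<in>I. norm (s i))"
    using big by (intro sum_mono) (simp add: s_def)
  also have "\<dots> = norm (\<Sum>i\<in>I. u i * s i)"
    unfolding us by (simp flip: of_real_sum add: sum_nonneg)
  also have "(\<Sum>i\<in>I. u i * s i) = (\<Sum>x\<in>A. G x)"
    unfolding G_def s_def by (subst sum.swap) (simp add: sum_distrib_left)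
  also have "norm (\<Sum>x\<in>A. G x) \<le> (\<Sum>x\<in>A. norm (G x))"
    by (rule norm_sum)
  finally have "(?K * (\<eta> * card A))\<^sup>2 \<le> (\<Sum>x\<in>A. norm (G x))\<^sup>2"
    using K assms by (intro power_mono) auto
  \<comment> \<open>Cauchy-Schwarz on \<open>A\<close>; the sum of squares is then enlarged to the
    whole cube, where the characters are almost orthogonal.\<close>
  also have "\<dots> \<le> (\<Sum>x\<in>A. (norm (G x))\<^sup>2) * card A"
    by (rule sum_squared_le_sum_of_squares)
  also have "\<dots> \<le> (\<Sum>x\<in>cube n. (norm (G x))\<^sup>2) * card A"
    using assms(2) finite_cube by (intro mult_right_mono sum_mono2) auto
  also have "\<dots> \<le> 2 ^ n * (?K + ?K\<^sup>2 * ?\<tau>) * card A"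
  proof (rule mult_right_mono)
    define E where "E i j = (\<Sum>x\<in>cube n. chr p (dot n (\<lambda>k. c i k - c j k) x))" for i j
    have "of_real (\<Sum>x\<in>cube n. (norm (G x))\<^sup>2) = (\<Sum>x\<in>cube n. G x * cnj (G x))"
      by (simp add: complex_norm_square flip: of_real_power)
    also have "\<dots> = (\<Sum>x\<in>cube n. \<Sum>i\<in>I. \<Sum>j\<in>I. u i * cnj (u j) * chr p (dot n (\<lambda>k. c i k - c j k) x))"
    proof (rule sum.cong[OF refl])
      fix x
      have "chr p (dot n (\<lambda>k. c i k - c j k) x) = chr p (dot n (c i) x) * cnj (chr p (dot n (c j) x))" for i j
        unfolding cnj_chr chr_add[symmetric]
        by (simp add: dot_def left_diff_distrib sum_subtractf)
      then show "G x * cnj (G x) = (\<Sum>i\<in>I. \<Sum>j\<in>I. u i * cnj (u j) * chr p (dot n (\<lambda>k. c i k - c j k) x))"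
        unfolding G_def cnj_sum sum_product by (intro sum.cong) auto
    qed
    also have "\<dots> = (\<Sum>i\<in>I. \<Sum>j\<in>I. u i * cnj (u j) * E i j)"
      unfolding E_def sum_distrib_left
      by (subst sum.swap, intro sum.cong refl, subst sum.swap) simp
    finally have eq: "of_real (\<Sum>x\<in>cube n. (norm (G x))\<^sup>2) = (\<Sum>i\<in>I. \<Sum>j\<in>I. u i * cnj (u j) * E i j)" .
    have Eb: "norm (E i j) \<le> 2 ^ n * ((if i = j then 1 else 0) + ?\<tau>)" if "i \<in> I" "j \<in> I" for i j
    proof (cases "i = j")
      case True
      then have "norm (E i j) = 2 ^ n"
        by (simp add: E_def dot_def card_cube norm_power)
      then show ?thesis using True assms by simp
    next
      case False
      then show ?thesis using orth[OF that False] by (simp add: E_def)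
    qed
    have "(\<Sum>x\<in>cube n. (norm (G x))\<^sup>2) = norm (complex_of_real (\<Sum>x\<in>cube n. (norm (G x))\<^sup>2))"
      unfolding norm_of_real by (simp add: sum_nonneg)
    also have "\<dots> \<le> (\<Sum>i\<in>I. \<Sum>j\<in>I. norm (u i * cnj (u j) * E i j))"
      unfolding eq by (intro order_trans[OF norm_sum] sum_mono norm_sum)
    also have "\<dots> \<le> (\<Sum>i\<in>I. \<Sum>j\<in>I. 2 ^ n * ((if i = j then 1 else 0) + ?\<tau>))"
    proof (intro sum_mono)
      fix i j assume ij: "i \<in> I" "j \<in> I"
      have "norm (u i * cnj (u j)) \<le> 1 * 1"
        unfolding norm_mult using u1 by (intro mult_mono) auto
      then have "norm (u i * cnj (u j)) * norm (E i j) \<le> 1 * norm (E i j)"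
        by (intro mult_right_mono) auto
      then show "norm (u i * cnj (u j) * E i j) \<le> 2 ^ n * ((if i = j then 1 else 0) + ?\<tau>)"
        using Eb[OF ij] by (simp add: norm_mult)
    qed
    also have "\<dots> = 2 ^ n * (?K + ?K\<^sup>2 * ?\<tau>)"
      using assms(1) by (simp add: sum.distrib power2_eq_square ring_distribs flip: sum_distrib_left)
    finally show "(\<Sum>x\<in>cube n. (norm (G x))\<^sup>2) \<le> 2 ^ n * (?K + ?K\<^sup>2 * ?\<tau>)" .
  qed simp
  also have "\<dots> \<le> (card A / \<delta>) * (?K + ?K\<^sup>2 * ?\<tau>) * card A"
    using assms K by (intro mult_right_mono) (auto simp: field_simps intro!: add_nonneg_nonneg)
  finally have "?K * (?K * \<eta>\<^sup>2) * (real (card A))\<^sup>2 \<le> ?K * ((1 + ?K * ?\<tau>) / \<delta>) * (real (card A))\<^sup>2"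
    using \<open>\<delta> > 0\<close> by (simp add: power2_eq_square algebra_simps add_divide_distrib)
  then have "?K * \<eta>\<^sup>2 \<le> (1 + ?K * ?\<tau>) / \<delta>"
    by (rule mult_left_le_imp_le[OF mult_right_le_imp_le]) (use K A in auto)
  \<comment> \<open>The off-diagonal term amounts to half of the left-hand side and is absorbed
    there; this is why the orthogonality error carries the factor 1/2.\<close>
  then show ?thesis
    using assms by (simp add: field_simps)
qed

section \<open>Biased and unbiased forms on a dense set\<close>

text \<open>\<open>U\<close> is split by the multiple \<open>t\<close> that witnesses the bias. As
  \<open>t\<close> is invertible modulo \<open>p\<close>, multiplying by it preserves Hamming
  distance, so the members of one class give almost orthogonal characters and the Bessel bound
  applies to each class.\<close>

lemma card_separated_biased_le:
  assumes "prime p" and "0 < \<rho>" "\<rho> < 1"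
    and rho: "\<And>r. \<not> int p dvd r \<Longrightarrow> norm (1 + chr p r) \<le> 2 * \<rho>"
    and "\<delta> > 0" "\<eta> > 0" and D: "\<rho> ^ D \<le> \<delta> * \<eta>\<^sup>2 / 2"
    and A: "A \<subseteq> cube n" "A \<noteq> {}" "real (card A) \<ge> \<delta> * 2 ^ n"
    and U: "finite U" "\<And>a. a \<in> U \<Longrightarrow> biased p n \<eta> A a"
      "\<And>a b. a \<in> U \<Longrightarrow> b \<in> U \<Longrightarrow> a \<noteq> b \<Longrightarrow> D \<le> hamming p n a b"
  shows "real (card U) \<le> real p * (2 / (\<delta> * \<eta>\<^sup>2))"
proof -
  have "\<forall>a\<in>U. \<exists>t. t \<in> {1..<p} \<and> norm (\<Sum>x\<in>A. chr p (int t * dot n a x)) > \<eta> * real (card A)"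
    using U(2) unfolding biased_def by blast
  then obtain T where T: "\<And>a. a \<in> U \<Longrightarrow> T a \<in> {1..<p}"
      "\<And>a. a \<in> U \<Longrightarrow> norm (\<Sum>x\<in>A. chr p (int (T a) * dot n a x)) > \<eta> * real (card A)"
    by metis
  have each: "real (card {a \<in> U. T a = t}) \<le> 2 / (\<delta> * \<eta>\<^sup>2)" if t: "t \<in> {1..<p}" for t
  proof (rule card_biased_characters_le[where A = A and c = "\<lambda>a k. int t * a k" and n = n and p = p])
    show "norm (\<Sum>x\<in>A. chr p (dot n (\<lambda>k. int t * a k) x)) \<ge> \<eta> * real (card A)"
      if "a \<in> {a \<in> U. T a = t}" for a
      using T(2)[of a] that by (simp add: dot_def sum_distrib_left mult.assoc)
    show "norm (\<Sum>x\<in>cube n. chr p (dot n (\<lambda>k. int t * a k - int t * b k) x)) \<le> 2 ^ n * (\<delta> * \<eta>\<^sup>2 / 2)"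
      if "a \<in> {a \<in> U. T a = t}" "b \<in> {a \<in> U. T a = t}" "a \<noteq> b" for a b
    proof -
      have "\<not> int p dvd int t" using t by (auto dest!: dvd_imp_le)
      then have "int p dvd int t * a k - int t * b k \<longleftrightarrow> int p dvd a k - b k" for k
        using assms(1) by (metis prime_dvd_mult_iff prime_nat_int_transfer right_diff_distrib)
      then have "D \<le> card {j \<in> {1..n}. \<not> int p dvd int t * a j - int t * b j}"
        using U(3)[of a b] that by (simp add: hamming_def)
      from norm_sum_chr_cube_le[OF assms(2,3) rho this]
      have "norm (\<Sum>x\<in>cube n. chr p (dot n (\<lambda>k. int t * a k - int t * b k) x)) \<le> 2 ^ n * \<rho> ^ D" .
      also have "\<dots> \<le> 2 ^ n * (\<delta> * \<eta>\<^sup>2 / 2)" using D by simp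
      finally show ?thesis .
    qed
  qed (use A U(1) \<open>\<delta> > 0\<close> \<open>\<eta> > 0\<close> in simp_all)
  have "card U = card (\<Union>t\<in>{1..<p}. {a \<in> U. T a = t})"
    using T(1) by (intro arg_cong[of _ _ card]) auto
  also have "\<dots> \<le> (\<Sum>t\<in>{1..<p}. card {a \<in> U. T a = t})"
    by (rule card_UN_le) simp
  finally have "real (card U) \<le> (\<Sum>t\<in>{1..<p}. real (card {a \<in> U. T a = t}))"
    by (simp only: of_nat_sum[symmetric] of_nat_le_iff)
  also have "\<dots> \<le> (\<Sum>t\<in>{1..<p}. 2 / (\<delta> * \<eta>\<^sup>2))"
    using each by (intro sum_mono) auto
  also have "\<dots> \<le> real p * (2 / (\<delta> * \<eta>\<^sup>2))"
    using \<open>\<delta> > 0\<close> by (simp add: mult_right_mono divide_right_mono)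
  finally show ?thesis .
qed

text \<open>Fourier inversion modulo \<open>p\<close>: the term \<open>t = 0\<close> gives the
  uniform share, and each of the other \<open>p - 1\<close> terms has size at most
  \<open>\<eta> * card A\<close>.\<close>

lemma unbiased_near_uniform:
  assumes "p > 0" and "finite A" "A \<noteq> {}" and "\<not> biased p n \<eta> A a" and "0 \<le> \<eta>"
  shows "real (card {x \<in> A. int p dvd dot n a x - d}) / real (card A) \<ge> 1 / real p - \<eta>"
proof -
  have A: "real (card A) > 0" using assms by (simp add: card_gt_0_iff)
  let ?N = "real (card {x \<in> A. int p dvd dot n a x - d})"
  define F where "F t = (\<Sum>x\<in>A. chr p (int t * (dot n a x - d)))" for t
  have "(\<Sum>t<p. F t) = (\<Sum>x\<in>A. \<Sum>t<p. chr p (int t * (dot n a x - d)))"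
    unfolding F_def by (rule sum.swap)
  also have "\<dots> = (\<Sum>x\<in>A. if int p dvd dot n a x - d then of_nat p else 0)"
    using sum_chr_multiples[OF assms(1)] by simp
  also have "\<dots> = of_real (real p * ?N)"
    using assms(2) by (simp add: sum.If_cases Int_def mult.commute)
  finally have eq: "(\<Sum>t<p. F t) = of_real (real p * ?N)" .
  have "{..<p} = insert 0 {1..<p}" using assms(1) by auto
  then have "(\<Sum>t<p. F t) = F 0 + (\<Sum>t\<in>{1..<p}. F t)" by simp
  moreover have "F 0 = of_real (real (card A))" by (simp add: F_def)
  ultimately have eq': "of_real (real (card A) - real p * ?N) = - (\<Sum>t\<in>{1..<p}. F t)"
    using eq by simp
  have "real (card A) - real p * ?N \<le> norm (complex_of_real (real (card A) - real p * ?N))"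
    by (simp only: norm_of_real abs_ge_self)
  also have "\<dots> \<le> (\<Sum>t\<in>{1..<p}. norm (F t))"
    unfolding eq' norm_minus_cancel by (rule norm_sum)
  also have "\<dots> \<le> (\<Sum>t\<in>{1..<p}. \<eta> * card A)"
  proof (rule sum_mono)
    fix t assume t: "t \<in> {1..<p}"
    have "F t = chr p (- int t * d) * (\<Sum>x\<in>A. chr p (int t * dot n a x))"
      unfolding F_def sum_distrib_left by (simp add: algebra_simps flip: chr_add)
    then have "norm (F t) = norm (\<Sum>x\<in>A. chr p (int t * dot n a x))"
      by (simp add: norm_mult)
    then show "norm (F t) \<le> \<eta> * card A"
      using assms(4) t by (auto simp: biased_def not_less)
  qed
  also have "\<dots> \<le> real p * (\<eta> * card A)"
    using assms by (simp add: mult_right_mono)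
  finally show ?thesis
    using A assms(1) by (simp add: field_simps)
qed

section \<open>Common centres of packed families\<close>

text \<open>The abstract setting serves twice: for forms under Hamming distance, with
  \<open>B i\<close> the forms biased on the \<open>i\<close>-th set, and for coordinates under the
  discrete metric. The sets \<open>B i\<close> may be infinite; only their separated subsets are
  bounded.\<close>

locale finite_packing =
  fixes d :: "'x \<Rightarrow> 'x \<Rightarrow> nat" and B :: "'i \<Rightarrow> 'x set" and I :: "'i set" and D K :: nat
  assumes d_refl: "d x x = 0" and d_commute: "d x y = d y x"
    and d_triangle: "d x z \<le> d x y + d y z"
    and finite_I: "finite I"
    and packing: "i \<in> I \<Longrightarrow> finite U \<Longrightarrow> U \<subseteq> B i \<Longrightarrow>
      (\<And>x y. x \<in> U \<Longrightarrow> y \<in> U \<Longrightarrow> x \<noteq> y \<Longrightarrow> D \<le> d x y) \<Longrightarrow> card U \<le> K"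
begin

text \<open>A separated subset of largest size is a net of radius \<open>D\<close>, since a point
  farther than \<open>D\<close> from all its members could be added.\<close>

lemma maximal_separated_subset:
  assumes "i \<in> I"
  shows "\<exists>U\<subseteq>B i. finite U \<and> card U \<le> K \<and> (\<forall>x\<in>B i. \<exists>u\<in>U. d u x \<le> D)"
proof -
  define P where "P U \<longleftrightarrow> finite U \<and> U \<subseteq> B i \<and> (\<forall>x\<in>U. \<forall>y\<in>U. x \<noteq> y \<longrightarrow> D \<le> d x y)" for U
  have "\<forall>U. P U \<longrightarrow> card U < Suc K"
    by (auto simp: P_def less_Suc_eq_le intro: packing[OF assms])
  moreover have "P {}" by (simp add: P_def)
  ultimately obtain U where U: "P U" and max: "\<forall>U'. P U' \<longrightarrow> card U' \<le> card U"
    using ex_has_greatest_nat[of P "{}" card "Suc K"] by blast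
  note U' = U[unfolded P_def]
  have "\<exists>u\<in>U. d u x \<le> D" if x: "x \<in> B i" for x
  proof (rule ccontr)
    assume far: "\<not> (\<exists>u\<in>U. d u x \<le> D)"
    then have "x \<notin> U" using d_refl by (metis le0)
    moreover have "P (insert x U)"
      using U' x far d_commute by (auto simp: P_def not_le intro: less_imp_le)
    ultimately show False
      using max[rule_format, of "insert x U"] U' by simp
  qed
  moreover have "card U \<le> K"
    using U' by (intro packing[OF assms]) auto
  ultimately show ?thesis using U' by (intro exI[of _ U]) simp
qed

text \<open>The set \<open>V\<close> is a largest \<open>3D\<close>-separated set all of whose points are near \<open>B i\<close> for a
  proportion \<open>\<gamma> ^ card V\<close> of the indices.\<close>

lemma common_centres:
  fixes \<gamma> :: real
  assumes "I \<noteq> {}" and "0 < \<gamma>"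
  shows "\<exists>V Q. finite V \<and> card V \<le> K \<and> Q \<subseteq> I \<and> real (card Q) \<ge> \<gamma> ^ card V * real (card I) \<and>
    (\<forall>v\<in>V. \<forall>i\<in>Q. \<exists>b\<in>B i. d v b \<le> D) \<and>
    real (card {(i, j) \<in> Q \<times> Q. \<exists>x \<in> B i \<inter> B j. \<forall>v\<in>V. 4 * D < d x v}) \<le> K * \<gamma> * (real (card Q))\<^sup>2"
proof -
  define near where "near x i \<longleftrightarrow> (\<exists>b\<in>B i. d x b \<le> D)" for x i
  define Q where "Q V = {i \<in> I. \<forall>v\<in>V. near v i}" for V
  define P where "P V \<longleftrightarrow> finite V \<and> (\<forall>x\<in>V. \<forall>y\<in>V. x \<noteq> y \<longrightarrow> 3 * D < d x y) \<and>
    real (card (Q V)) \<ge> \<gamma> ^ card V * real (card I)" for V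
  have I: "real (card I) > 0" using assms finite_I by (simp add: card_gt_0_iff)
  have finQ: "finite (Q V)" for V using finite_I by (simp add: Q_def)
  \<comment> \<open>Some \<open>B i\<close> has points within \<open>D\<close> of all members of
    \<open>V\<close>. As those members are more than \<open>3 * D\<close> apart, the nearby points
    are more than \<open>D\<close> apart and the packing bound applies.\<close>
  have le: "card V \<le> K" if "P V" for V
  proof -
    note V = that[unfolded P_def]
    have "0 < \<gamma> ^ card V * real (card I)" using I assms by simp
    then have "Q V \<noteq> {}" using V by (metis card.empty of_nat_0 not_less)
    then obtain i where i: "i \<in> I" "\<forall>v\<in>V. near v i" by (auto simp: Q_def)
    then obtain f where f: "\<And>v. v \<in> V \<Longrightarrow> f v \<in> B i \<and> d v (f v) \<le> D"
      unfolding near_def by metis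
    have sep: "D < d (f v) (f w)" if "v \<in> V" "w \<in> V" "v \<noteq> w" for v w
    proof -
      have "3 * D < d v w" using V that by blast
      moreover have "d v w \<le> d v (f v) + d (f v) w" "d (f v) w \<le> d (f v) (f w) + d (f w) w"
        by (rule d_triangle)+
      ultimately show ?thesis
        using f[OF that(1)] f[OF that(2)] d_commute[of "f w" w] by linarith
    qed
    then have inj: "inj_on f V"
      using d_refl by (metis inj_onI not_less0)
    have "card (f ` V) \<le> K"
      using V f sep by (intro packing[OF i(1)]) (auto intro: less_imp_le)
    then show ?thesis using card_image[OF inj] by simp
  qed
  have "P {}" by (simp add: P_def Q_def)
  moreover have "\<forall>V. P V \<longrightarrow> card V < Suc K" using le by (simp add: less_Suc_eq_le)
  ultimately obtain V where V: "P V" and max: "\<forall>V'. P V' \<longrightarrow> card V' \<le> card V"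
    using ex_has_greatest_nat[of P "{}" card "Suc K"] by blast
  note V' = V[unfolded P_def]
  \<comment> \<open>Maximality of \<open>V\<close>: a point far from \<open>V\<close> and near
    \<open>B i\<close> for more than a proportion \<open>\<gamma>\<close> of the indices could be
    added to \<open>V\<close>.\<close>
  have few: "real (card {i \<in> Q V. near x i}) \<le> \<gamma> * real (card (Q V))"
    if x: "\<forall>v\<in>V. 3 * D < d x v" for x
  proof (rule ccontr)
    assume many: "\<not> ?thesis"
    have "x \<notin> V" using x d_refl by (metis not_less0)
    moreover have "Q (insert x V) = {i \<in> Q V. near x i}" by (auto simp: Q_def)
    moreover have "\<gamma> * (\<gamma> ^ card V * real (card I)) \<le> \<gamma> * real (card (Q V))"
      using V' assms by (intro mult_left_mono) auto
    ultimately have "P (insert x V)"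
      using V' x many d_commute by (auto simp: P_def mult.assoc)
    then show False using max[rule_format, of "insert x V"] V' \<open>x \<notin> V\<close> by simp
  qed
  let ?bad = "\<lambda>i. {j \<in> Q V. \<exists>x \<in> B i \<inter> B j. \<forall>v\<in>V. 4 * D < d x v}"
  have bad: "real (card (?bad i)) \<le> K * \<gamma> * real (card (Q V))" if "i \<in> Q V" for i
  proof -
    have "i \<in> I" using that by (simp add: Q_def)
    then obtain U where U: "U \<subseteq> B i" "finite U" "card U \<le> K" "\<forall>x\<in>B i. \<exists>u\<in>U. d u x \<le> D"
      using maximal_separated_subset by blast
    \<comment> \<open>If \<open>x\<close> lies in \<open>B i\<close> and \<open>B j\<close> and is
      farther than \<open>4 * D\<close> from \<open>V\<close>, its net point is farther than
      \<open>3 * D\<close> from \<open>V\<close> and near \<open>B j\<close>. Thus each bad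
      \<open>j\<close> is charged to one of at most \<open>K\<close> net points, each of which
      accounts for few indices.\<close>
    define U' where "U' = {u \<in> U. \<forall>v\<in>V. 3 * D < d u v}"
    have U': "finite U'" "card U' \<le> K"
      using U card_mono[OF U(2), of U'] by (auto simp: U'_def)
    have "?bad i \<subseteq> (\<Union>u\<in>U'. {j \<in> Q V. near u j})"
    proof
      fix j assume "j \<in> ?bad i"
      then obtain x where x: "j \<in> Q V" "x \<in> B i" "x \<in> B j" "\<forall>v\<in>V. 4 * D < d x v" by auto
      then obtain u where u: "u \<in> U" "d u x \<le> D" using U by blast
      have "3 * D < d u v" if "v \<in> V" for v
        using x(4)[rule_format, OF that] u(2) d_triangle[of x v u] d_commute[of x u] by linarith
      then show "j \<in> (\<Union>u\<in>U'. {j \<in> Q V. near u j})"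
        using u x by (auto simp: U'_def near_def)
    qed
    then have "card (?bad i) \<le> card (\<Union>u\<in>U'. {j \<in> Q V. near u j})"
      using finQ U' by (intro card_mono) auto
    also have "\<dots> \<le> (\<Sum>u\<in>U'. card {j \<in> Q V. near u j})"
      using U' by (intro card_UN_le)
    finally have "real (card (?bad i)) \<le> (\<Sum>u\<in>U'. real (card {j \<in> Q V. near u j}))"
      by (simp only: of_nat_sum[symmetric] of_nat_le_iff)
    also have "\<dots> \<le> (\<Sum>u\<in>U'. \<gamma> * real (card (Q V)))"
      using few by (intro sum_mono) (auto simp: U'_def)
    also have "\<dots> = card U' * (\<gamma> * real (card (Q V)))" by simp
    also have "\<dots> \<le> K * (\<gamma> * real (card (Q V)))"
      using U' assms by (intro mult_right_mono) auto
    finally show ?thesis by (simp add: mult.assoc)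
  qed
  have "{(i, j) \<in> Q V \<times> Q V. \<exists>x \<in> B i \<inter> B j. \<forall>v\<in>V. 4 * D < d x v} = Sigma (Q V) ?bad"
    by auto
  then have "real (card {(i, j) \<in> Q V \<times> Q V. \<exists>x \<in> B i \<inter> B j. \<forall>v\<in>V. 4 * D < d x v})
      = (\<Sum>i\<in>Q V. real (card (?bad i)))"
    using finQ by (simp add: card_SigmaI)
  also have "\<dots> \<le> (\<Sum>i\<in>Q V. K * \<gamma> * real (card (Q V)))"
    using bad by (intro sum_mono) auto
  also have "\<dots> = K * \<gamma> * (real (card (Q V)))\<^sup>2"
    by (simp add: power2_eq_square)
  finally have "real (card {(i, j) \<in> Q V \<times> Q V. \<exists>x \<in> B i \<inter> B j. \<forall>v\<in>V. 4 * D < d x v})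
      \<le> K * \<gamma> * (real (card (Q V)))\<^sup>2" .
  moreover have "\<forall>v\<in>V. \<forall>i\<in>Q V. \<exists>b\<in>B i. d v b \<le> D"
    by (auto simp: Q_def near_def)
  moreover have "Q V \<subseteq> I" by (auto simp: Q_def)
  ultimately show ?thesis
    using V' le[OF V] by blast
qed

end

section \<open>Energy and saturated coordinates\<close>

definition cell_count :: "'a set \<Rightarrow> ('a \<Rightarrow> 'c) \<Rightarrow> 'c \<Rightarrow> real" where
  "cell_count A g c = real (card {x \<in> A. g x = c})"

text \<open>A normalised sum of squared cell sizes, where a cell fixes \<open>h x\<close> and the
  bits in \<open>J\<close>. With the factor \<open>2 ^ card J\<close>, revealing more coordinates
  cannot lower the energy, while it stays at most \<open>2 ^ n * card A\<close>.\<close>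

definition energy ::
    "(nat \<Rightarrow> int) set \<Rightarrow> 'c set \<Rightarrow> ((nat \<Rightarrow> int) \<Rightarrow> 'c) \<Rightarrow> nat set \<Rightarrow> real" where
  "energy A H h J = 2 ^ card J *
     (\<Sum>c\<in>H \<times> (J \<rightarrow>\<^sub>E {0, 1}). (cell_count A (\<lambda>x. (h x, restrict x J)) c)\<^sup>2)"

lemma sum_cell_count:
  assumes "finite A" "finite C" "g ` A \<subseteq> C"
  shows "(\<Sum>c\<in>C. cell_count A g c * F c) = (\<Sum>x\<in>A. F (g x))"
proof -
  have "(\<Sum>x\<in>A. F (g x)) = (\<Sum>c\<in>C. \<Sum>x\<in>{x. x \<in> A \<and> g x = c}. F (g x))"
    by (rule sum.group[symmetric]) (use assms in auto)
  also have "\<dots> = (\<Sum>c\<in>C. cell_count A g c * F c)"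
    by (intro sum.cong refl) (simp add: cell_count_def)
  finally show ?thesis by simp
qed

lemma restrict_cube: "x \<in> cube n \<Longrightarrow> J \<subseteq> {1..n} \<Longrightarrow> restrict x J \<in> J \<rightarrow>\<^sub>E {0, 1}"
  unfolding cube_def restrict_PiE_iff by (blast dest: PiE_mem)

lemma card_cube_fibre_le:
  assumes "J \<subseteq> {1..n}"
  shows "card {x \<in> cube n. restrict x J = y} \<le> 2 ^ (n - card J)"
proof -
  let ?R = "\<lambda>x. restrict x ({1..n} - J)"
  have "inj_on ?R {x \<in> cube n. restrict x J = y}"
  proof (rule inj_onI)
    fix x x' assume x: "x \<in> {x \<in> cube n. restrict x J = y}" "x' \<in> {x \<in> cube n. restrict x J = y}"
      and eq: "?R x = ?R x'"
    show "x = x'"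
    proof (rule ext)
      fix j
      have "restrict x J j = restrict x' J j" using x by simp
      moreover have "x j = x' j" if "j \<notin> {1..n}"
        using x PiE_arb[OF _ that] unfolding cube_def by (metis (no_types, lifting) mem_Collect_eq)
      ultimately show "x j = x' j"
        using fun_cong[OF eq, of j] by (cases "j \<in> J"; cases "j \<in> {1..n}") auto
    qed
  qed
  moreover have "?R ` {x \<in> cube n. restrict x J = y} \<subseteq> ({1..n} - J) \<rightarrow>\<^sub>E {0, 1}"
    using restrict_cube[of _ n "{1..n} - J"] by blast
  moreover have "finite (({1..n} - J) \<rightarrow>\<^sub>E {0::int, 1})"
    by (intro finite_PiE) auto
  ultimately have "card {x \<in> cube n. restrict x J = y} \<le> card (({1..n} - J) \<rightarrow>\<^sub>E {0::int, 1})"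
    using card_inj_on_le by blast
  also have "\<dots> = 2 ^ card ({1..n} - J)"
    by (subst card_funcsetE) (auto simp: numeral_2_eq_2)
  also have "card ({1..n} - J) = n - card J"
    using assms by (simp add: card_Diff_subset finite_subset)
  finally show ?thesis .
qed

lemma finite_bits: "finite J \<Longrightarrow> finite (J \<rightarrow>\<^sub>E {0::int, 1})"
  by (intro finite_PiE) auto

lemma card_bits: "finite J \<Longrightarrow> card (J \<rightarrow>\<^sub>E {0::int, 1}) = 2 ^ card J"
  by (subst card_funcsetE) (auto simp: numeral_2_eq_2)

text \<open>A cell fixes \<open>card J\<close> bits, hence has at most
  \<open>2 ^ (n - card J)\<close> points; this bounds one factor of each square, and the other
  factors sum to \<open>card A\<close>.\<close>

lemma energy_le:
  assumes A: "A \<subseteq> cube n" and H: "finite H" "h ` A \<subseteq> H" and J: "J \<subseteq> {1..n}"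
  shows "energy A H h J \<le> 2 ^ n * real (card A)"
proof -
  let ?g = "\<lambda>x. (h x, restrict x J)" and ?C = "H \<times> (J \<rightarrow>\<^sub>E {0::int, 1})"
  have fin: "finite A" "finite J" using A J finite_cube finite_subset by blast+
  have "card J \<le> n" using card_mono[OF _ J] by simp
  have gC: "?g ` A \<subseteq> ?C" using A H restrict_cube[OF _ J] by blast
  have le: "cell_count A ?g c \<le> 2 ^ (n - card J)" for c
  proof -
    have "{x \<in> A. ?g x = c} \<subseteq> {x \<in> cube n. restrict x J = snd c}" using A by auto
    then have "card {x \<in> A. ?g x = c} \<le> card {x \<in> cube n. restrict x J = snd c}"
      using finite_cube by (intro card_mono) auto
    also have "\<dots> \<le> 2 ^ (n - card J)" by (rule card_cube_fibre_le[OF J])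
    finally show ?thesis by (simp add: cell_count_def flip: of_nat_le_iff)
  qed
  have "energy A H h J \<le> 2 ^ card J * (\<Sum>c\<in>?C. cell_count A ?g c * 2 ^ (n - card J))"
    unfolding energy_def power2_eq_square
    by (intro mult_left_mono sum_mono mult_left_mono le) (auto simp: cell_count_def)
  also have "\<dots> = 2 ^ card J * (real (card A) * 2 ^ (n - card J))"
    using fin H gC finite_bits[OF fin(2)] by (subst sum_cell_count) auto
  also have "\<dots> = 2 ^ (card J + (n - card J)) * real (card A)"
    by (simp add: power_add)
  finally show ?thesis using \<open>card J \<le> n\<close> by simp
qed

lemma cell_count_pair_sum:
  assumes A: "A \<subseteq> cube n" and S: "S \<subseteq> {1..n}"
  shows "(\<Sum>z\<in>S \<rightarrow>\<^sub>E {0, 1}. cell_count A (\<lambda>x. (g x, restrict x S)) (c, z)) = cell_count A g c"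
proof -
  have fin: "finite A" "finite S" using A S finite_cube finite_subset by blast+
  have "cell_count A g c = (\<Sum>x\<in>{x \<in> A. g x = c}. 1)"
    by (simp add: cell_count_def)
  also have "\<dots> = (\<Sum>z\<in>S \<rightarrow>\<^sub>E {0, 1}. \<Sum>x\<in>{x. x \<in> {x \<in> A. g x = c} \<and> restrict x S = z}. 1)"
  proof (rule sum.group[symmetric])
    show "(\<lambda>x. restrict x S) ` {x \<in> A. g x = c} \<subseteq> S \<rightarrow>\<^sub>E {0, 1}"
      using A restrict_cube[OF _ S] by blast
  qed (use fin finite_bits in auto)
  finally show ?thesis
    by (simp add: cell_count_def conj_assoc)
qed

lemma energy_union:
  assumes A: "A \<subseteq> cube n" and H: "finite H" and J: "J \<subseteq> {1..n}" and S: "S \<subseteq> {1..n}" "S \<inter> J = {}"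
  shows "energy A H h (J \<union> S) = 2 ^ card J * 2 ^ card S *
    (\<Sum>(c, z)\<in>(H \<times> (J \<rightarrow>\<^sub>E {0, 1})) \<times> (S \<rightarrow>\<^sub>E {0, 1}).
       (cell_count A (\<lambda>x. ((h x, restrict x J), restrict x S)) (c, z))\<^sup>2)"
proof -
  have fin: "finite J" "finite S" using J S finite_subset by blast+
  let ?C = "(H \<times> (J \<rightarrow>\<^sub>E {0::int, 1})) \<times> (S \<rightarrow>\<^sub>E {0::int, 1})"
  \<comment> \<open>Splitting a bit pattern on \<open>J \<union> S\<close> into its two parts, and
    gluing them back; the two maps are inverse because \<open>S\<close> and \<open>J\<close> are
    disjoint.\<close>
  define f where "f = (\<lambda>(a :: 'a, y :: nat \<Rightarrow> int). ((a, restrict y J), restrict y S))"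
  define f' where "f' = (\<lambda>((a :: 'a, y :: nat \<Rightarrow> int), z). (a, \<lambda>j\<in>J \<union> S. if j \<in> J then y j else z j))"
  have "(\<Sum>c\<in>H \<times> (J \<union> S \<rightarrow>\<^sub>E {0, 1}). (cell_count A (\<lambda>x. (h x, restrict x (J \<union> S))) c)\<^sup>2)
    = (\<Sum>(c, z)\<in>?C. (cell_count A (\<lambda>x. ((h x, restrict x J), restrict x S)) (c, z))\<^sup>2)"
  proof (rule sum.reindex_bij_witness[where j = f and i = f'])
    show "f' (f c) = c" if "c \<in> H \<times> (J \<union> S \<rightarrow>\<^sub>E {0, 1})" for c
      using that by (auto simp: f_def f'_def fun_eq_iff PiE_def extensional_def restrict_def)
    show "f c \<in> ?C" if "c \<in> H \<times> (J \<union> S \<rightarrow>\<^sub>E {0, 1})" for c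
      using that by (auto simp: f_def)
    show "f (f' c) = c" if "c \<in> ?C" for c
      using that S(2) by (auto simp: f_def f'_def fun_eq_iff PiE_def extensional_def restrict_def)
    show "f' c \<in> H \<times> (J \<union> S \<rightarrow>\<^sub>E {0, 1})" if "c \<in> ?C" for c
    proof -
      obtain a y z where c: "c = ((a, y), z)" "a \<in> H" "y \<in> J \<rightarrow>\<^sub>E {0, 1}" "z \<in> S \<rightarrow>\<^sub>E {0, 1}"
        using \<open>c \<in> ?C\<close> by auto
      have "(if j \<in> J then y j else z j) \<in> {0, 1}" if "j \<in> J \<union> S" for j
        using that PiE_mem[OF c(3), of j] PiE_mem[OF c(4), of j] by auto
      then have "(\<lambda>j\<in>J \<union> S. if j \<in> J then y j else z j) \<in> J \<union> S \<rightarrow>\<^sub>E {0, 1}"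
        unfolding restrict_PiE_iff by blast
      then show ?thesis
        unfolding c(1) f'_def prod.case by (rule SigmaI[OF c(2)])
    qed
    fix c assume c: "c \<in> H \<times> (J \<union> S \<rightarrow>\<^sub>E {0::int, 1})"
    have inj: "restrict x (J \<union> S) = y \<longleftrightarrow> restrict x J = restrict y J \<and> restrict x S = restrict y S"
      if "y \<in> J \<union> S \<rightarrow>\<^sub>E {0::int, 1}" for x y :: "nat \<Rightarrow> int"
    proof
      assume "restrict x (J \<union> S) = y"
      then have y: "y = restrict x (J \<union> S)" ..
      show "restrict x J = restrict y J \<and> restrict x S = restrict y S"
        unfolding y by (simp add: Int_absorb1)
    next
      assume eq: "restrict x J = restrict y J \<and> restrict x S = restrict y S"
      show "restrict x (J \<union> S) = y"
      proof
        fix j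
        have "restrict x J j = restrict y J j" "restrict x S j = restrict y S j"
          using eq by simp_all
        then show "restrict x (J \<union> S) j = y j"
          using PiE_arb[OF that, of j] by (cases "j \<in> J"; cases "j \<in> S") auto
      qed
    qed
    have "{x \<in> A. (h x, restrict x (J \<union> S)) = c} = {x \<in> A. ((h x, restrict x J), restrict x S) = f c}"
      using c inj by (cases c) (auto simp: f_def)
    then show "(case f c of (c, z) \<Rightarrow> (cell_count A (\<lambda>x. ((h x, restrict x J), restrict x S)) (c, z))\<^sup>2) =
        (cell_count A (\<lambda>x. (h x, restrict x (J \<union> S))) c)\<^sup>2"
      by (simp add: cell_count_def split: prod.split)
  qed
  moreover have "card (J \<union> S) = card J + card S"
    using fin S by (intro card_Un_disjoint) auto
  ultimately show ?thesis
    by (simp add: energy_def power_add)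
qed

text \<open>Resampling the coordinates in \<open>S\<close> uniformly, given \<open>h x\<close> and the coordinates in \<open>J\<close>,
  can only matter if revealing \<open>S\<close> increases the energy.\<close>

lemma energy_increment:
  fixes E :: "'c \<Rightarrow> (nat \<Rightarrow> int) \<Rightarrow> (nat \<Rightarrow> int) \<Rightarrow> bool"
  assumes A: "A \<subseteq> cube n" and H: "finite H" "h ` A \<subseteq> H"
    and J: "J \<subseteq> {1..n}" and S: "S \<subseteq> {1..n}" "S \<inter> J = {}"
  shows "((\<Sum>x\<in>A. real (card {z \<in> S \<rightarrow>\<^sub>E {0, 1}. E (h x) (restrict x J) z}) / 2 ^ card S)
      - real (card {x \<in> A. E (h x) (restrict x J) (restrict x S)}))\<^sup>2
    \<le> real (card H) * (energy A H h (J \<union> S) - energy A H h J)"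
proof -
  have fin: "finite A" "finite J" "finite S" using A J S finite_cube finite_subset by blast+
  let ?g = "\<lambda>x. (h x, restrict x J)"
  let ?C = "H \<times> (J \<rightarrow>\<^sub>E {0::int, 1})" and ?Z = "S \<rightarrow>\<^sub>E {0::int, 1}"
  define P where "P c = cell_count A ?g c" for c
  define R where "R c z = cell_count A (\<lambda>x. (?g x, restrict x S)) (c, z)" for c z
  define q :: real where "q = 1 / 2 ^ card S"
  define e where "e c z = (if E (fst c) (snd c) z then 1 else 0 :: real)" for c z
  have finC: "finite ?C" "finite ?Z" using H fin finite_bits by auto
  have gC: "?g ` A \<subseteq> ?C" using A H restrict_cube[OF _ J] by blast
  have gC': "(\<lambda>x. (?g x, restrict x S)) ` A \<subseteq> ?C \<times> ?Z"
  proof (rule image_subsetI)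
    fix x assume x: "x \<in> A"
    show "(?g x, restrict x S) \<in> ?C \<times> ?Z"
      using A x by (intro SigmaI[OF subsetD[OF gC imageI[OF x]]] restrict_cube[OF _ S(1)]) auto
  qed
  have cardZ: "real (card ?Z) = 2 ^ card S" using card_bits[OF fin(3)] by simp
  have RP: "(\<Sum>z\<in>?Z. R c z) = P c" for c
    unfolding R_def P_def by (rule cell_count_pair_sum[OF A S(1)])
  \<comment> \<open>The \<open>2 ^ card S\<close> counts \<open>R c z\<close> have mean
    \<open>q * P c\<close>, so this is the variance identity. Summed over \<open>c\<close>, it
    identifies the normalised energy gain with the squared deviation from uniform bits.\<close>
  have var: "(\<Sum>z\<in>?Z. (q * P c - R c z)\<^sup>2) = (\<Sum>z\<in>?Z. (R c z)\<^sup>2) - q * (P c)\<^sup>2" for c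
  proof -
    have "(\<Sum>z\<in>?Z. (q * P c - R c z)\<^sup>2) = (\<Sum>z\<in>?Z. (q * P c)\<^sup>2 - 2 * q * P c * R c z + (R c z)\<^sup>2)"
      by (simp add: power2_diff algebra_simps)
    also have "\<dots> = 2 ^ card S * (q * P c)\<^sup>2 - 2 * q * P c * P c + (\<Sum>z\<in>?Z. (R c z)\<^sup>2)"
      by (simp add: sum.distrib sum_subtractf RP[symmetric] cardZ flip: sum_distrib_left)
    also have "2 ^ card S * (q * P c)\<^sup>2 = q * (P c)\<^sup>2"
      by (simp add: q_def power2_eq_square)
    finally show ?thesis by (simp add: power2_eq_square)
  qed
  have t1: "(\<Sum>x\<in>A. real (card {z \<in> ?Z. E (h x) (restrict x J) z}) / 2 ^ card S)
      = (\<Sum>c\<in>?C. \<Sum>z\<in>?Z. q * P c * e c z)"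
  proof -
    have "(\<Sum>x\<in>A. real (card {z \<in> ?Z. E (h x) (restrict x J) z}) / 2 ^ card S)
        = (\<Sum>x\<in>A. (\<lambda>c. \<Sum>z\<in>?Z. q * e c z) (?g x))"
      using finC by (intro sum.cong refl)
        (simp add: e_def q_def Int_def sum.If_cases flip: sum_distrib_left sum_divide_distrib)
    also have "\<dots> = (\<Sum>c\<in>?C. P c * (\<Sum>z\<in>?Z. q * e c z))"
      unfolding P_def by (rule sum_cell_count[symmetric, OF fin(1) finC(1) gC])
    finally show ?thesis by (simp add: sum_distrib_left mult_ac)
  qed
  have t2: "real (card {x \<in> A. E (h x) (restrict x J) (restrict x S)})
      = (\<Sum>c\<in>?C. \<Sum>z\<in>?Z. R c z * e c z)"
  proof -
    have "real (card {x \<in> A. E (h x) (restrict x J) (restrict x S)})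
        = (\<Sum>x\<in>A. (\<lambda>(c, z). e c z) (?g x, restrict x S))"
      using fin by (simp add: e_def sum.If_cases Int_def)
    also have "\<dots> = (\<Sum>c\<in>?C \<times> ?Z. cell_count A (\<lambda>x. (?g x, restrict x S)) c * (\<lambda>(c, z). e c z) c)"
      by (rule sum_cell_count[symmetric]) (use fin finC gC' in auto)
    finally show ?thesis
      by (simp add: sum.cartesian_product R_def split_def)
  qed
  have one: "(\<Sum>(c, z)\<in>?C \<times> ?Z. (1::real)) = real (card H) * (2 ^ card J * 2 ^ card S)"
    using card_bits[OF fin(2)] card_bits[OF fin(3)] by (simp add: split_def card_cartesian_product)
  have dev: "(\<Sum>(c, z)\<in>?C \<times> ?Z. (q * P c - R c z)\<^sup>2)
      = (\<Sum>c\<in>?C. (\<Sum>z\<in>?Z. (R c z)\<^sup>2)) - q * (\<Sum>c\<in>?C. (P c)\<^sup>2)"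
    by (simp add: sum.cartesian_product[symmetric] var sum_subtractf sum_distrib_left)
  \<comment> \<open>Cauchy-Schwarz against the indicator \<open>e\<close>. Its square sum is at most
    the number of cells, whose powers of two are exactly the normalisation of the energy.\<close>
  have "((\<Sum>c\<in>?C. \<Sum>z\<in>?Z. q * P c * e c z) - (\<Sum>c\<in>?C. \<Sum>z\<in>?Z. R c z * e c z))\<^sup>2
      = (\<Sum>(c, z)\<in>?C \<times> ?Z. e c z * (q * P c - R c z))\<^sup>2"
    by (simp add: sum.cartesian_product[symmetric] sum_subtractf[symmetric] algebra_simps)
  also have "\<dots> \<le> (\<Sum>(c, z)\<in>?C \<times> ?Z. (e c z)\<^sup>2) * (\<Sum>(c, z)\<in>?C \<times> ?Z. (q * P c - R c z)\<^sup>2)"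
    using Cauchy_Schwarz_ineq_sum[of "\<lambda>(c, z). e c z" "\<lambda>(c, z). q * P c - R c z" "?C \<times> ?Z"]
    by (simp add: split_def)
  also have "\<dots> \<le> (\<Sum>(c, z)\<in>?C \<times> ?Z. 1) * (\<Sum>(c, z)\<in>?C \<times> ?Z. (q * P c - R c z)\<^sup>2)"
    by (intro mult_right_mono sum_mono sum_nonneg) (auto simp: e_def)
  also have "\<dots> = real (card H) * (2 ^ card J * 2 ^ card S) *
      ((\<Sum>c\<in>?C. (\<Sum>z\<in>?Z. (R c z)\<^sup>2)) - q * (\<Sum>c\<in>?C. (P c)\<^sup>2))"
    unfolding one dev ..
  also have "\<dots> = real (card H) * (energy A H h (J \<union> S) - energy A H h J)"
    unfolding energy_union[OF A H(1) J S] unfolding energy_def P_def[symmetric] R_def[symmetric]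
      sum.cartesian_product[symmetric]
    by (simp add: q_def right_diff_distrib mult.assoc)
  finally show ?thesis
    unfolding t1 t2 .
qed

text \<open>\<open>J\<close> maximises the energy minus a penalty \<open>\<theta>\<close> per
  coordinate. Comparison with the empty set bounds \<open>card J\<close>; comparison with
  \<open>J \<union> S\<close> shows that revealing \<open>S\<close> gains at most
  \<open>\<theta> * L\<close>, which makes the resampling error small for every event
  \<open>E\<close> at once.\<close>

lemma exists_saturated_coordinates:
  assumes A: "A \<subseteq> cube n" "A \<noteq> {}" and dens: "real (card A) \<ge> \<delta> * 2 ^ n" "\<delta> > 0"
    and H: "finite H" "h ` A \<subseteq> H" and N: "card H \<le> N" and "N > 0" and "L > 0" and "\<eta> > 0"
  shows "\<exists>J\<subseteq>{1..n}. real (card J) \<le> real N * real L / (\<delta> * \<eta>\<^sup>2) \<and>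
    (\<forall>S E. S \<subseteq> {1..n} \<longrightarrow> S \<inter> J = {} \<longrightarrow> card S \<le> L \<longrightarrow>
      (\<Sum>x\<in>A. real (card {z \<in> S \<rightarrow>\<^sub>E {0, 1}. E (h x) (restrict x J) z}) / 2 ^ card S)
      \<le> real (card {x \<in> A. E (h x) (restrict x J) (restrict x S)}) + \<eta> * real (card A))"
proof -
  have finA: "finite A" using A finite_cube finite_subset by blast
  then have cA: "real (card A) > 0" using A by (simp add: card_gt_0_iff)
  \<comment> \<open>Chosen so that the increment bound \<open>N * (\<theta> * L)\<close> equals
    \<open>(\<eta> * card A)\<^sup>2\<close>.\<close>
  define \<theta> where "\<theta> = \<eta>\<^sup>2 * (real (card A))\<^sup>2 / (real N * real L)"
  have \<theta>: "\<theta> > 0" using assms cA by (simp add: \<theta>_def)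
  let ?f = "\<lambda>J. energy A H h J - \<theta> * real (card J)"
  obtain J where J: "J \<in> Pow {1..n}" and max: "\<And>J'. J' \<in> Pow {1..n} \<Longrightarrow> ?f J' \<le> ?f J"
  proof -
    have fin: "finite (?f ` Pow {1..n})" and ne: "?f ` Pow {1..n} \<noteq> {}" by auto
    from Max_in[OF this] obtain J where "J \<in> Pow {1..n}" "Max (?f ` Pow {1..n}) = ?f J" by auto
    moreover have "?f J' \<le> Max (?f ` Pow {1..n})" if "J' \<in> Pow {1..n}" for J'
      using fin that by (intro Max_ge imageI)
    ultimately show thesis by (intro that[of J]) simp_all
  qed
  then have J': "J \<subseteq> {1..n}" by simp
  have "0 \<le> energy A H h {}" by (simp add: energy_def sum_nonneg)
  then have "\<theta> * real (card J) \<le> energy A H h J" using max[of "{}"] by simp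
  also have "\<dots> \<le> 2 ^ n * real (card A)" by (rule energy_le[OF A(1) H J'])
  also have "\<dots> \<le> real (card A) / \<delta> * real (card A)"
    using dens cA by (intro mult_right_mono) (auto simp: field_simps)
  finally have "\<theta> * real (card J) \<le> (real (card A))\<^sup>2 / \<delta>"
    by (simp add: power2_eq_square)
  then have "real (card J) \<le> (real (card A))\<^sup>2 / \<delta> / \<theta>"
    by (subst pos_le_divide_eq[OF \<theta>]) (simp add: mult.commute)
  also have "\<dots> = real N * real L / (\<delta> * \<eta>\<^sup>2)"
    using cA by (simp add: \<theta>_def)
  finally have cardJ: "real (card J) \<le> real N * real L / (\<delta> * \<eta>\<^sup>2)" .
  have test: "(\<Sum>x\<in>A. real (card {z \<in> S \<rightarrow>\<^sub>E {0, 1}. E (h x) (restrict x J) z}) / 2 ^ card S)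
      \<le> real (card {x \<in> A. E (h x) (restrict x J) (restrict x S)}) + \<eta> * real (card A)" (is "?l \<le> ?r + _")
    if S: "S \<subseteq> {1..n}" "S \<inter> J = {}" "card S \<le> L" for S E
  proof -
    have finS: "finite S" "finite J" using S J' finite_subset by blast+
    have "card (J \<union> S) = card J + card S"
      using finS S by (intro card_Un_disjoint) auto
    then have inc: "energy A H h (J \<union> S) - energy A H h J \<le> \<theta> * real (card S)"
      using max[of "J \<union> S"] J' S by (simp add: ring_distribs)
    also have "\<dots> \<le> \<theta> * real L" using \<theta> S by simp
    finally have inc: "energy A H h (J \<union> S) - energy A H h J \<le> \<theta> * real L" .
    have "(?l - ?r)\<^sup>2 \<le> real (card H) * (energy A H h (J \<union> S) - energy A H h J)"
      by (rule energy_increment[OF A(1) H J' S(1,2)])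
    also have "\<dots> \<le> real (card H) * (\<theta> * real L)"
      using inc by (intro mult_left_mono) auto
    also have "\<dots> \<le> real N * (\<theta> * real L)"
      using N \<theta> by (intro mult_right_mono) auto
    also have "\<dots> = (\<eta> * real (card A))\<^sup>2"
      using assms by (simp add: \<theta>_def power_mult_distrib)
    finally have "(?l - ?r)\<^sup>2 \<le> (\<eta> * real (card A))\<^sup>2" .
    then have "?l - ?r \<le> \<eta> * real (card A)"
      by (rule power2_le_imp_le) (use cA \<open>\<eta> > 0\<close> in simp)
    then show ?thesis by simp
  qed
  show ?thesis by (intro exI[of _ J] conjI allI impI J' cardJ test)
qed

section \<open>Overlap of tuples\<close>

text \<open>Pigeonhole over the residues. The popular residue is recorded as the value at a cube
  point \<open>z\<close>, so that it can later be realised by actual bits; for empty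
  \<open>X\<close> any point serves.\<close>

lemma exists_popular_value:
  fixes f :: "(nat \<Rightarrow> int) \<Rightarrow> int"
  assumes "finite X" and "X \<subseteq> cube n" and "p > 0"
  shows "\<exists>z\<in>cube n. card X \<le> p * card {x \<in> X. int p dvd f x - f z}"
proof (cases "X = {}")
  case True
  have "(\<lambda>j\<in>{1..n}. 0) \<in> cube n"
    by (simp add: cube_def restrict_PiE_iff)
  then show ?thesis using True by auto
next
  case False
  have "(\<lambda>x. f x mod int p) \<in> X \<rightarrow> {0..<int p}" "{0..<int p} \<noteq> {}"
    using assms(3) by auto
  then obtain y where y: "card X \<le> card ((\<lambda>x. f x mod int p) -` {y} \<inter> X) * card {0..<int p}"
    using pigeonhole_card[OF _ assms(1)] by (metis finite_atLeastLessThan_int)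
  have "card X > 0" using False assms(1) by (simp add: card_gt_0_iff)
  then have "(\<lambda>x. f x mod int p) -` {y} \<inter> X \<noteq> {}" using y by (metis card.empty leD mult_0)
  then obtain z where z: "z \<in> X" "f z mod int p = y" by auto
  have "(\<lambda>x. f x mod int p) -` {y} \<inter> X = {x \<in> X. int p dvd f x - f z}"
    using z by (auto simp: mod_eq_dvd_iff[symmetric])
  then show ?thesis using y z assms(2) by (auto simp: mult.commute)
qed

text \<open>\<open>T\<close> proposes a value on which all sets of the tuple can agree, reading only
  \<open>h x\<close> and the bits in \<open>J0\<close>. On each \<open>A k\<close> the form meets
  this target at a cost of a factor \<open>p\<close> for its own block of coordinates and
  \<open>2 ^ (p - 1)\<close> for the bits outside \<open>J k\<close>.\<close>

lemma common_target:
  fixes A :: "'k \<Rightarrow> (nat \<Rightarrow> int) set" and h :: "(nat \<Rightarrow> int) \<Rightarrow> 'c" and g :: "'c \<Rightarrow> int"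
    and b :: "nat \<Rightarrow> int" and J :: "'k \<Rightarrow> nat set" and \<eta> :: real
  assumes "p > 0" and M: "finite M"
    and A: "\<And>k. k \<in> M \<Longrightarrow> A k \<subseteq> cube n"
    and J: "\<And>k. k \<in> M \<Longrightarrow> J0 \<subseteq> J k" "\<And>k. k \<in> M \<Longrightarrow> J k \<subseteq> {1..n}"
      "\<And>k l. k \<in> M \<Longrightarrow> l \<in> M \<Longrightarrow> k \<noteq> l \<Longrightarrow> J k \<inter> J l \<subseteq> J0"
    and L: "card {j \<in> {1..n}. \<not> int p dvd b j} \<le> L"
    and resample: "\<And>k S E. k \<in> M \<Longrightarrow> S \<subseteq> {1..n} \<Longrightarrow> S \<inter> J k = {} \<Longrightarrow> card S \<le> L \<Longrightarrow>
      (\<Sum>x\<in>A k. real (card {z \<in> S \<rightarrow>\<^sub>E {0, 1}. E (h x) (restrict x (J k)) z}) / 2 ^ card S)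
      \<le> real (card {x \<in> A k. E (h x) (restrict x (J k)) (restrict x S)}) + \<eta> * real (card (A k))"
  shows "\<exists>T :: 'c \<Rightarrow> (nat \<Rightarrow> int) \<Rightarrow> int. (\<forall>c y. T c y \<in> {0..<int p}) \<and>
    (\<forall>k\<in>M. \<forall>d. real (card {x \<in> A k. T (h x) (restrict x J0) = d}) \<le>
      real p * 2 ^ (p - 1) *
        (real (card {x \<in> A k. int p dvd g (h x) + dot n b x - d}) + \<eta> * real (card (A k))))"
proof -
  define S where "S = {j \<in> {1..n}. \<not> int p dvd b j}"
  define psi where "psi U x = (\<Sum>j\<in>U. b j * x j)" for U and x :: "nat \<Rightarrow> int"
  \<comment> \<open>The private part of the support for \<open>k\<close>. These blocks are pairwise
    disjoint, since distinct \<open>J k\<close> meet only inside \<open>J0\<close>.\<close>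
  define blk where "blk k = S \<inter> J k - J0" for k
  have finA: "finite (A k)" if "k \<in> M" for k
    using A[OF that] finite_cube finite_subset by blast
  have finS: "finite S" by (simp add: S_def)
  have psi_restrict: "psi U (restrict x W) = psi U x" if "U \<subseteq> W" for U W x
    unfolding psi_def using that by (intro sum.cong) auto
  have psi_S: "int p dvd dot n b x - psi S x" for x
  proof -
    have "dot n b x = psi S x + psi ({1..n} - S) x"
      unfolding dot_def psi_def by (subst sum.subset_diff[of S]) (auto simp: S_def)
    moreover have "int p dvd psi ({1..n} - S) x"
      unfolding psi_def by (intro dvd_sum) (auto simp: S_def)
    ultimately show ?thesis by simp
  qed
  let ?cell = "\<lambda>k c y. {x \<in> A k. h x = c \<and> restrict x J0 = y}"
  have ex: "\<exists>z. z \<in> cube n \<and> (k \<in> M \<longrightarrow>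
      card (?cell k c y) \<le> p * card {x \<in> ?cell k c y. int p dvd psi (blk k) x - psi (blk k) z})" for k c y
  proof (cases "k \<in> M")
    case True
    have "\<exists>z\<in>cube n. card (?cell k c y) \<le> p * card {x \<in> ?cell k c y. int p dvd psi (blk k) x - psi (blk k) z}"
      by (rule exists_popular_value) (use A[OF True] finA[OF True] assms(1) in auto)
    then show ?thesis by blast
  next
    case False
    then show ?thesis using exists_popular_value[of "{}" n p] assms(1) by auto
  qed
  define Z where "Z k c y = (SOME z. z \<in> cube n \<and> (k \<in> M \<longrightarrow>
      card (?cell k c y) \<le> p * card {x \<in> ?cell k c y. int p dvd psi (blk k) x - psi (blk k) z}))" for k c y
  have Zprop: "Z k c y \<in> cube n \<and> (k \<in> M \<longrightarrow>
      card (?cell k c y) \<le> p * card {x \<in> ?cell k c y. int p dvd psi (blk k) x - psi (blk k) (Z k c y)})" for k c y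
    unfolding Z_def by (rule someI_ex[OF ex])
  have Z: "Z k c y \<in> cube n" for k c y
    using Zprop by (rule conjunct1)
  have pop: "card (?cell k c y) \<le> p * card {x \<in> ?cell k c y. int p dvd psi (blk k) x - psi (blk k) (Z k c y)}"
    if "k \<in> M" for k c y
    using Zprop that by (rule conjunct2[THEN mp])
  define v where "v k c y = psi (blk k) (Z k c y)" for k c y
  \<comment> \<open>The known contributions of \<open>g\<close> and \<open>J0\<close>, plus one
    popular value for the block of each set. Support outside all \<open>J l\<close> is intended to
    contribute zero.\<close>
  define T where "T c y = (g c + psi (S \<inter> J0) y + (\<Sum>l\<in>M. v l c y)) mod int p" for c y
  have "real (card {x \<in> A k. T (h x) (restrict x J0) = d}) \<le>
      real p * 2 ^ (p - 1) *
        (real (card {x \<in> A k. int p dvd g (h x) + dot n b x - d}) + \<eta> * real (card (A k)))"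
    if k: "k \<in> M" for k d
  proof -
    \<comment> \<open>The support not exposed for \<open>k\<close>: the blocks of the other sets,
      and what lies in no \<open>J l\<close>. These bits can be resampled.\<close>
    define S' where "S' = S - J k"
    have S': "S' \<subseteq> {1..n}" "S' \<inter> J k = {}" "card S' \<le> L" "finite S'"
      using L card_mono[OF finS, of S'] finS by (auto simp: S'_def S_def)
    \<comment> \<open>The own block takes its popular value, and the resampled bits produce the sum
      of the popular values of the other blocks; together they hit the target
      \<open>d\<close>.\<close>
    define E where "E c y z \<longleftrightarrow> int p dvd psi (blk k) y - v k c (restrict y J0) \<and>
      int p dvd psi S' z - (\<Sum>l\<in>M - {k}. v l c (restrict y J0)) \<and> T c (restrict y J0) = d" for c y z
    have rr: "restrict (restrict x (J k)) J0 = restrict x J0" for x :: "nat \<Rightarrow> int"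
      using J(1)[OF k] by (simp add: Int_absorb1)
    have E_iff: "E (h x) (restrict x (J k)) z \<longleftrightarrow>
      int p dvd psi (blk k) x - v k (h x) (restrict x J0) \<and>
      int p dvd psi S' z - (\<Sum>l\<in>M - {k}. v l (h x) (restrict x J0)) \<and> T (h x) (restrict x J0) = d" for x z
      unfolding E_def rr by (subst psi_restrict) (auto simp: blk_def)
    define X0 where "X0 = {x \<in> A k. T (h x) (restrict x J0) = d}"
    define X1 where "X1 = {x \<in> X0. int p dvd psi (blk k) x - v k (h x) (restrict x J0)}"
    have hit: "{x \<in> A k. E (h x) (restrict x (J k)) (restrict x S')} \<subseteq>
        {x \<in> A k. int p dvd g (h x) + dot n b x - d}"
    proof clarify
      fix x assume "x \<in> A k" and e: "E (h x) (restrict x (J k)) (restrict x S')"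
      let ?y = "restrict x J0" and ?c = "h x"
      have e': "int p dvd psi (blk k) x - v k ?c ?y"
        "int p dvd psi S' x - (\<Sum>l\<in>M - {k}. v l ?c ?y)" "T ?c ?y = d"
        using e unfolding E_iff by (simp_all add: psi_restrict)
      have "psi S x = psi (S \<inter> J k) x + psi S' x"
        unfolding psi_def S'_def by (rule sum.Int_Diff[OF finS])
      moreover have "psi (S \<inter> J k) x = psi (S \<inter> J0) x + psi (blk k) x"
      proof -
        have eq: "S \<inter> J k = (S \<inter> J0) \<union> blk k" using J(1)[OF k] by (auto simp: blk_def)
        show ?thesis
          unfolding psi_def eq by (rule sum.union_disjoint) (use finS in \<open>auto simp: blk_def\<close>)
      qed
      moreover have "psi (S \<inter> J0) x = psi (S \<inter> J0) ?y" by (simp add: psi_restrict)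
      moreover have "(\<Sum>l\<in>M. v l ?c ?y) = v k ?c ?y + (\<Sum>l\<in>M - {k}. v l ?c ?y)"
        using M k by (simp add: sum.remove)
      moreover have "int p dvd g ?c + psi (S \<inter> J0) ?y + (\<Sum>l\<in>M. v l ?c ?y) - d"
        using e'(3) by (metis T_def minus_mod_eq_mult_div dvd_triv_left)
      ultimately have "int p dvd g ?c + psi S x - d"
        using dvd_add[OF dvd_add[OF e'(1,2)], of "g ?c + psi (S \<inter> J0) ?y + (\<Sum>l\<in>M. v l ?c ?y) - d"]
        by (simp add: algebra_simps)
      from dvd_add[OF this psi_S[of x]] show "int p dvd g ?c + dot n b x - d"
        by (simp add: algebra_simps)
    qed
    have mass: "1 / 2 ^ (p - 1) \<le> real (card {z \<in> S' \<rightarrow>\<^sub>E {0, 1}. E (h x) (restrict x (J k)) z}) / 2 ^ card S'"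
      if x: "x \<in> X1" for x
    proof -
      let ?y = "restrict x J0" and ?c = "h x"
      \<comment> \<open>\<open>z0\<close> is a pattern attaining the required sum: it copies the
        popular point of \<open>l\<close> on \<open>blk l\<close> and is 0 elsewhere, where
        \<open>lab j\<close> is the unique owner of \<open>j\<close>. One such pattern suffices for
        the count of patterns with the same value.\<close>
      define lab where "lab j = (SOME l. l \<in> M - {k} \<and> j \<in> blk l)" for j
      define z0 where "z0 j = (if \<exists>l\<in>M - {k}. j \<in> blk l then Z (lab j) ?c ?y j else 0)" for j
      have z01: "z0 j \<in> {0, 1}" if "j \<in> S'" for j
        using Z[of "lab j" ?c ?y] that S'(1) unfolding z0_def cube_def by (auto dest: PiE_mem)
      have disj: "blk l \<inter> blk l' = {}" if "l \<in> M" "l' \<in> M" "l \<noteq> l'" for l l'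
        using J(3)[OF that] by (auto simp: blk_def)
      have lab: "lab j = l" if "l \<in> M - {k}" "j \<in> blk l" for j l
        unfolding lab_def using that disj by (intro some_equality) blast+
      have sub: "(\<Union>l\<in>M - {k}. blk l) \<subseteq> S'"
        using J(3)[OF _ k] by (fastforce simp: blk_def S'_def)
      have "psi S' z0 = psi (\<Union>l\<in>M - {k}. blk l) z0"
        unfolding psi_def using S'(4) sub by (intro sum.mono_neutral_right) (auto simp: z0_def)
      also have "\<dots> = (\<Sum>l\<in>M - {k}. psi (blk l) z0)"
        unfolding psi_def using M disj finS by (intro sum.UNION_disjoint) (auto simp: blk_def)
      also have "\<dots> = (\<Sum>l\<in>M - {k}. v l ?c ?y)"
        unfolding psi_def v_def using lab by (intro sum.cong refl) (auto simp: z0_def)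
      finally have z0: "psi S' z0 = (\<Sum>l\<in>M - {k}. v l ?c ?y)" .
      have "2 ^ card S' \<le> 2 ^ (p - 1) *
          card {z \<in> S' \<rightarrow>\<^sub>E {0, 1}. [(\<Sum>j\<in>S'. b j * z j) = (\<Sum>j\<in>S'. b j * z0 j)] (mod int p)}"
        by (rule card_attained_value_ge[OF S'(4) assms(1) z01])
      also have "{z \<in> S' \<rightarrow>\<^sub>E {0, 1}. [(\<Sum>j\<in>S'. b j * z j) = (\<Sum>j\<in>S'. b j * z0 j)] (mod int p)}
          = {z \<in> S' \<rightarrow>\<^sub>E {0, 1}. E ?c (restrict x (J k)) z}"
        using x unfolding E_iff X1_def X0_def by (simp add: psi_def[symmetric] z0 cong_iff_dvd_diff)
      finally have "real (2 ^ card S') \<le>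
          real (2 ^ (p - 1) * card {z \<in> S' \<rightarrow>\<^sub>E {0, 1}. E ?c (restrict x (J k)) z})"
        by (rule of_nat_mono)
      then show ?thesis by (simp add: field_simps)
    qed
    have "real (card X1) / 2 ^ (p - 1) = (\<Sum>x\<in>X1. 1 / 2 ^ (p - 1))" by simp
    also have "\<dots> \<le> (\<Sum>x\<in>X1. real (card {z \<in> S' \<rightarrow>\<^sub>E {0, 1}. E (h x) (restrict x (J k)) z}) / 2 ^ card S')"
      by (rule sum_mono[OF mass])
    also have "\<dots> \<le> (\<Sum>x\<in>A k. real (card {z \<in> S' \<rightarrow>\<^sub>E {0, 1}. E (h x) (restrict x (J k)) z}) / 2 ^ card S')"
      using finA[OF k] by (intro sum_mono2) (auto simp: X1_def X0_def)
    also have "\<dots> \<le> real (card {x \<in> A k. E (h x) (restrict x (J k)) (restrict x S')}) + \<eta> * real (card (A k))"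
      by (rule resample[OF k S'(1-3)])
    also have "\<dots> \<le> real (card {x \<in> A k. int p dvd g (h x) + dot n b x - d}) + \<eta> * real (card (A k))"
      using card_mono[OF _ hit] finA[OF k] by simp
    finally have X1: "real (card X1) / 2 ^ (p - 1) \<le>
      real (card {x \<in> A k. int p dvd g (h x) + dot n b x - d}) + \<eta> * real (card (A k))" .
    define C where "C = (\<lambda>x. (h x, restrict x J0)) ` A k"
    have cells: "card X = (\<Sum>c\<in>C. card {x. x \<in> X \<and> (h x, restrict x J0) = c})" if "X \<subseteq> A k" for X
      by (rule card_eq_sum_fibres) (use that finA[OF k] finite_subset[OF that] in \<open>auto simp: C_def\<close>)
    have "card X0 = (\<Sum>c\<in>C. card {x. x \<in> X0 \<and> (h x, restrict x J0) = c})"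
      by (rule cells) (auto simp: X0_def)
    \<comment> \<open>\<open>T\<close> is constant on a cell. Either the whole cell belongs to
      \<open>X0\<close>, and popularity costs a factor \<open>p\<close>, or the cell misses
      \<open>X0\<close>.\<close>
    also have "\<dots> \<le> (\<Sum>c\<in>C. p * card {x. x \<in> X1 \<and> (h x, restrict x J0) = c})"
    proof (rule sum_mono)
      fix c :: "'c \<times> (nat \<Rightarrow> int)"
      obtain a y where c: "c = (a, y)" by (cases c)
      show "card {x. x \<in> X0 \<and> (h x, restrict x J0) = c} \<le> p * card {x. x \<in> X1 \<and> (h x, restrict x J0) = c}"
      proof (cases "T a y = d")
        case True
        then have "{x. x \<in> X0 \<and> (h x, restrict x J0) = c} = ?cell k a y"
          "{x. x \<in> X1 \<and> (h x, restrict x J0) = c} = {x \<in> ?cell k a y. int p dvd psi (blk k) x - psi (blk k) (Z k a y)}"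
          by (auto simp: X0_def X1_def c v_def)
        then show ?thesis using pop[OF k, of a y] by (simp only:)
      next
        case False
        then have "{x. x \<in> X0 \<and> (h x, restrict x J0) = c} = {}"
          by (auto simp: X0_def c)
        then show ?thesis by (simp only: card.empty le0)
      qed
    qed
    also have "\<dots> = p * card X1"
      by (subst cells[of X1]) (auto simp: X0_def X1_def sum_distrib_left)
    finally have "real (card X0) \<le> real p * real (card X1)"
      by (simp only: of_nat_mult[symmetric] of_nat_le_iff)
    also have "\<dots> = real p * 2 ^ (p - 1) * (real (card X1) / 2 ^ (p - 1))" by simp
    also have "\<dots> \<le> real p * 2 ^ (p - 1) *
        (real (card {x \<in> A k. int p dvd g (h x) + dot n b x - d}) + \<eta> * real (card (A k)))"
      using X1 by (intro mult_left_mono) auto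
    finally show ?thesis unfolding X0_def .
  qed
  moreover have "T c y \<in> {0..<int p}" for c y
    using assms(1) by (simp add: T_def)
  ultimately show ?thesis by (intro exI[of _ T]) blast
qed

section \<open>Point masses and coefficient vectors of forms\<close>

lemma pmf_map_pmf_of_set:
  assumes "finite A" "A \<noteq> {}"
  shows "pmf (map_pmf f (pmf_of_set A)) d = real (card {x \<in> A. f x = d}) / real (card A)"
proof -
  have "A \<inter> f -` {d} = {x \<in> A. f x = d}" by auto
  then show ?thesis
    using assms by (simp add: pmf_map measure_pmf_of_set)
qed

lemma overlap_ge:
  assumes "m \<ge> 1" and "\<And>d k. d \<in> D \<Longrightarrow> k \<in> {1..m} \<Longrightarrow> G d \<le> pmf (X k) d"
  shows "sum G D \<le> overlap D m X"
  unfolding overlap_def using assms by (intro sum_mono) (auto simp: Min_ge_iff)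

text \<open>A cube point is the indicator of its support, so adding one coordinate at a time
  expresses \<open>\<phi>\<close> through its values \<open>a j\<close> at the unit vectors.\<close>

lemma mod_form_eq_dot:
  assumes "p > 1" and "mod_form p n \<phi>"
  shows "\<exists>a. \<forall>x\<in>cube n. \<phi> x = dot n a x mod int p"
proof -
  define ind :: "nat set \<Rightarrow> nat \<Rightarrow> int" where "ind T = (\<lambda>i\<in>{1..n}. if i \<in> T then 1 else 0)" for T
  define a where "a j = \<phi> (ind {j})" for j
  have ind: "ind T \<in> Fp_vec p n" for T
    using assms(1) unfolding Fp_vec_def ind_def restrict_PiE_iff by (simp add: residue_ring_def)
  have add: "\<phi> (\<lambda>i\<in>{1..n}. (x i + y i) mod int p) = (\<phi> x + \<phi> y) mod int p"
    if "x \<in> Fp_vec p n" "y \<in> Fp_vec p n" for x y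
    using assms(2) that unfolding mod_form_def by (simp add: residue_ring_def)
  have rng: "\<phi> (ind T) \<in> {0..int p - 1}" for T
    using assms(2) ind[of T] unfolding mod_form_def by (auto simp: residue_ring_def)
  have union: "\<phi> (ind (insert j T)) = (a j + \<phi> (ind T)) mod int p" if "j \<notin> T" for j T
  proof -
    have "ind (insert j T) = (\<lambda>i\<in>{1..n}. (ind {j} i + ind T i) mod int p)"
      using assms(1) that by (auto simp: ind_def fun_eq_iff)
    then show ?thesis using add[OF ind ind, of "{j}" T] by (simp add: a_def)
  qed
  have val: "\<phi> (ind T) = (\<Sum>j\<in>T. a j) mod int p" if "finite T" for T
    using that
  proof (induction T rule: finite_induct)
    case empty
    \<comment> \<open>The zero vector is twice itself, so its image equals its double modulo
      \<open>p\<close> and vanishes.\<close>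
    have "ind {} = (\<lambda>i\<in>{1..n}. (ind {} i + ind {} i) mod int p)"
      by (auto simp: ind_def)
    then have eq: "\<phi> (ind {}) = (\<phi> (ind {}) + \<phi> (ind {})) mod int p"
      using add[OF ind ind, of "{}" "{}"] by simp
    then have "int p dvd \<phi> (ind {}) + \<phi> (ind {}) - \<phi> (ind {})"
      using rng[of "{}"] by (subst mod_eq_dvd_iff[symmetric]) simp
    then show ?case
      using rng[of "{}"] zdvd_not_zless[of "\<phi> (ind {})" "int p"] by (cases "\<phi> (ind {}) > 0") auto
  next
    case (insert j T)
    then show ?case
      using union[of j T] by (simp add: mod_add_right_eq)
  qed
  have rep: "x = ind {j \<in> {1..n}. x j = 1} \<and> dot n a x = (\<Sum>j\<in>{j \<in> {1..n}. x j = 1}. a j)"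
    if x: "x \<in> cube n" for x
  proof
    have x01: "x j = 0 \<or> x j = 1" if "j \<in> {1..n}" for j
      using PiE_mem[OF x[unfolded cube_def] that] by simp
    show "x = ind {j \<in> {1..n}. x j = 1}"
    proof
      fix j
      show "x j = ind {j \<in> {1..n}. x j = 1} j"
        using x01[of j] PiE_arb[OF x[unfolded cube_def], of j]
        by (cases "j \<in> {1..n}") (auto simp: ind_def)
    qed
    have "dot n a x = (\<Sum>j\<in>{1..n}. if x j = 1 then a j else 0)"
      unfolding dot_def using x01 by (intro sum.cong) fastforce+
    also have "\<dots> = (\<Sum>j\<in>{j \<in> {1..n}. x j = 1}. a j)"
      by (rule sum.inter_filter[symmetric]) simp
    finally show "dot n a x = (\<Sum>j\<in>{j \<in> {1..n}. x j = 1}. a j)" .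
  qed
  have "\<phi> x = dot n a x mod int p" if x: "x \<in> cube n" for x
  proof -
    have "\<phi> x = \<phi> (ind {j \<in> {1..n}. x j = 1})"
      by (rule arg_cong[OF conjunct1[OF rep[OF x]]])
    also have "\<dots> = (\<Sum>j\<in>{j \<in> {1..n}. x j = 1}. a j) mod int p"
      by (rule val) simp
    finally show ?thesis unfolding conjunct2[OF rep[OF x]] .
  qed
  then show ?thesis by blast
qed

section \<open>Counting tuples and passing to subfamilies\<close>

lemma card_tuples_with_pair_le:
  assumes "finite Q" "k \<in> {1..m}" "l \<in> {1..m}" "k \<noteq> l" and "P \<subseteq> Q \<times> Q"
  shows "card {t \<in> {1..m} \<rightarrow>\<^sub>E Q. (t k, t l) \<in> P} \<le> card P * card Q ^ (m - 2)"
proof -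
  let ?R = "{1..m} - {k, l}"
  let ?f = "\<lambda>t. ((t k, t l), restrict t ?R)"
  have finP: "finite P" using assms finite_subset by blast
  have "inj_on ?f {t \<in> {1..m} \<rightarrow>\<^sub>E Q. (t k, t l) \<in> P}"
  proof (rule inj_onI)
    fix t u assume t: "t \<in> {t \<in> {1..m} \<rightarrow>\<^sub>E Q. (t k, t l) \<in> P}"
      and u: "u \<in> {t \<in> {1..m} \<rightarrow>\<^sub>E Q. (t k, t l) \<in> P}" and eq: "?f t = ?f u"
    show "t = u"
    proof
      fix j
      have "restrict t ?R j = restrict u ?R j" "t k = u k" "t l = u l" using eq by simp_all
      moreover have "t j = u j" if "j \<notin> {1..m}"
        using t u PiE_arb[OF _ that, of t "\<lambda>_. Q"] PiE_arb[OF _ that, of u "\<lambda>_. Q"] by simp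
      ultimately show "t j = u j"
        by (cases "j \<in> {1..m}"; cases "j = k"; cases "j = l") auto
    qed
  qed
  moreover have "?f ` {t \<in> {1..m} \<rightarrow>\<^sub>E Q. (t k, t l) \<in> P} \<subseteq> P \<times> (?R \<rightarrow>\<^sub>E Q)"
  proof (rule image_subsetI)
    fix t assume t: "t \<in> {t \<in> {1..m} \<rightarrow>\<^sub>E Q. (t k, t l) \<in> P}"
    then have "restrict t ?R \<in> ?R \<rightarrow>\<^sub>E Q"
      unfolding restrict_PiE_iff by (blast dest: PiE_mem)
    then show "?f t \<in> P \<times> (?R \<rightarrow>\<^sub>E Q)" using t by (intro SigmaI) auto
  qed
  moreover have "finite (P \<times> (?R \<rightarrow>\<^sub>E Q))"
    using finP assms(1) by (intro finite_cartesian_product finite_PiE) auto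
  ultimately have "card {t \<in> {1..m} \<rightarrow>\<^sub>E Q. (t k, t l) \<in> P} \<le> card (P \<times> (?R \<rightarrow>\<^sub>E Q))"
    by (rule card_inj_on_le)
  also have "card ?R = m - 2"
    using assms by (simp add: card_Diff_subset)
  then have "card (P \<times> (?R \<rightarrow>\<^sub>E Q)) = card P * card Q ^ (m - 2)"
    by (simp add: card_cartesian_product card_funcsetE)
  finally show ?thesis .
qed

text \<open>Union bound over at most \<open>m ^ 2\<close> pairs of positions. \<open>P\<close> may
  contain diagonal pairs, so tuples with repeated entries are covered as well.\<close>

lemma card_good_tuples_ge:
  fixes \<theta> :: real
  assumes "finite Q" "m \<ge> 2" and P: "P \<subseteq> Q \<times> Q" "real (card P) \<le> \<theta> * (real (card Q))\<^sup>2"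
    and good: "\<And>t. t \<in> {1..m} \<rightarrow>\<^sub>E Q \<Longrightarrow>
      (\<And>k l. k \<in> {1..m} \<Longrightarrow> l \<in> {1..m} \<Longrightarrow> k \<noteq> l \<Longrightarrow> (t k, t l) \<notin> P) \<Longrightarrow> G t"
  shows "real (card {t \<in> {1..m} \<rightarrow>\<^sub>E Q. G t}) \<ge> (1 - (real m)\<^sup>2 * \<theta>) * real (card Q) ^ m"
proof -
  let ?T = "{1..m} \<rightarrow>\<^sub>E Q"
  let ?K = "{(k, l) \<in> {1..m} \<times> {1..m}. k \<noteq> l}"
  let ?b = "\<lambda>(k, l). {t \<in> ?T. (t k, t l) \<in> P}"
  have finT: "finite ?T" using assms(1) by (intro finite_PiE) auto
  have finK: "finite ?K" by (rule finite_subset[of _ "{1..m} \<times> {1..m}"]) auto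
  have "card ?K \<le> card ({1..m} \<times> {1..m})" by (intro card_mono) auto
  then have cardK: "real (card ?K) \<le> (real m)\<^sup>2"
    by (simp add: card_cartesian_product power2_eq_square flip: of_nat_mult)
  have "?T \<subseteq> {t \<in> ?T. G t} \<union> (\<Union>q\<in>?K. ?b q)"
    using good by fastforce
  moreover have "finite (\<Union>q\<in>?K. ?b q)"
    by (rule finite_subset[OF _ finT]) auto
  ultimately have "card ?T \<le> card ({t \<in> ?T. G t} \<union> (\<Union>q\<in>?K. ?b q))"
    using finT by (intro card_mono) auto
  also have "\<dots> \<le> card {t \<in> ?T. G t} + card (\<Union>q\<in>?K. ?b q)"
    by (rule card_Un_le)
  also have "card (\<Union>q\<in>?K. ?b q) \<le> (\<Sum>q\<in>?K. card (?b q))"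
    by (rule card_UN_le[OF finK])
  also have "\<dots> \<le> (\<Sum>q\<in>?K. card P * card Q ^ (m - 2))"
    using card_tuples_with_pair_le[OF assms(1) _ _ _ P(1)] by (intro sum_mono) auto
  also have "\<dots> = card ?K * (card P * card Q ^ (m - 2))" by simp
  finally have "real (card ?T) \<le> real (card {t \<in> ?T. G t} + card ?K * (card P * card Q ^ (m - 2)))"
    by (simp only: of_nat_le_iff add_le_cancel_left)
  then have "real (card Q) ^ m \<le> real (card {t \<in> ?T. G t}) + real (card ?K) * (real (card P) * real (card Q) ^ (m - 2))"
    by (simp add: card_funcsetE)
  also have "real (card ?K) * (real (card P) * real (card Q) ^ (m - 2))
      \<le> (real m)\<^sup>2 * (\<theta> * (real (card Q))\<^sup>2 * real (card Q) ^ (m - 2))"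
    using cardK P(2) by (intro mult_mono mult_right_mono) auto
  also have "\<dots> = (real m)\<^sup>2 * \<theta> * real (card Q) ^ (2 + (m - 2))"
    by (simp only: power_add mult.assoc)
  also have "2 + (m - 2) = m" using assms(2) by simp
  finally show ?thesis by (simp add: algebra_simps)
qed

text \<open>Pigeonhole on the vectors \<open>P i\<close> rounded down to multiples of
  \<open>1 / r\<close>, of which there are at most \<open>(r + 1) ^ card C\<close>.\<close>

lemma exists_similar_subfamily:
  fixes P :: "'i \<Rightarrow> 'c \<Rightarrow> real"
  assumes "finite Q" "finite C" and P: "\<And>i c. i \<in> Q \<Longrightarrow> 0 \<le> P i c \<and> P i c \<le> 1" and "r > 0"
  shows "\<exists>Q'\<subseteq>Q. card Q \<le> card Q' * (r + 1) ^ card C \<and>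
    (\<forall>i\<in>Q'. \<forall>j\<in>Q'. \<forall>c\<in>C. P i c \<le> P j c + 1 / real r)"
proof -
  define f where "f i = (\<lambda>c\<in>C. nat \<lfloor>real r * P i c\<rfloor>)" for i
  let ?Y = "C \<rightarrow>\<^sub>E {0..r}"
  have "f \<in> Q \<rightarrow> ?Y"
  proof
    fix i assume i: "i \<in> Q"
    have "nat \<lfloor>real r * P i c\<rfloor> \<le> r" for c
    proof -
      have "real r * P i c \<le> real r * 1" using P[OF i] by (intro mult_left_mono) auto
      then show ?thesis by linarith
    qed
    then show "f i \<in> ?Y" unfolding f_def restrict_PiE_iff by simp
  qed
  moreover have "finite ?Y" using assms(2) by (intro finite_PiE) auto
  moreover have "?Y \<noteq> {}" by (simp add: PiE_eq_empty_iff)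
  ultimately obtain y where y: "card Q \<le> card (f -` {y} \<inter> Q) * card ?Y"
    using pigeonhole_card[of f Q ?Y] assms(1) by blast
  define Q' where "Q' = f -` {y} \<inter> Q"
  have "P i c \<le> P j c + 1 / real r" if "i \<in> Q'" "j \<in> Q'" "c \<in> C" for i j c
  proof -
    have "f i c = f j c" using that by (auto simp: Q'_def)
    then have eq: "nat \<lfloor>real r * P i c\<rfloor> = nat \<lfloor>real r * P j c\<rfloor>"
      using that by (simp add: f_def)
    have "0 \<le> real r * P i c" "0 \<le> real r * P j c"
      using that P by (auto simp: Q'_def)
    with eq have "real r * P i c \<le> real r * P j c + 1" by linarith
    then show ?thesis using assms(4) by (simp add: field_simps)
  qed
  moreover have "card ?Y = (r + 1) ^ card C"
    using assms(2) by (simp add: card_funcsetE)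
  ultimately show ?thesis
    using y by (intro exI[of _ Q']) (auto simp: Q'_def)
qed

text \<open>Such an event is a disjoint union of cells, and each cell contributes an error of at
  most \<open>\<eta>\<close>.\<close>

lemma similar_laws_events:
  fixes A B :: "'a set"
  assumes "finite A" "finite B" "finite C" "cell ` A \<subseteq> C" "cell ` B \<subseteq> C"
    and "\<And>c. c \<in> C \<Longrightarrow> real (card {x \<in> A. cell x = c}) / real (card A)
      \<le> real (card {x \<in> B. cell x = c}) / real (card B) + \<eta>" and "\<eta> \<ge> 0"
  shows "real (card {x \<in> A. E (cell x)}) / real (card A)
      \<le> real (card {x \<in> B. E (cell x)}) / real (card B) + real (card C) * \<eta>"
proof -
  let ?C = "{c \<in> C. E c}"
  have ev: "real (card {x \<in> X. E (cell x)}) / real (card X) =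
      (\<Sum>c\<in>?C. real (card {x \<in> X. cell x = c}) / real (card X))" if "finite X" "cell ` X \<subseteq> C" for X
  proof -
    have "card {x \<in> X. E (cell x)} = (\<Sum>c\<in>?C. card {x. x \<in> {x \<in> X. E (cell x)} \<and> cell x = c})"
      by (rule card_eq_sum_fibres) (use that assms(3) in auto)
    also have "\<dots> = (\<Sum>c\<in>?C. card {x \<in> X. cell x = c})"
      by (intro sum.cong refl arg_cong[of _ _ card]) auto
    finally show ?thesis by (simp add: sum_divide_distrib)
  qed
  have "real (card {x \<in> A. E (cell x)}) / real (card A)
      \<le> (\<Sum>c\<in>?C. real (card {x \<in> B. cell x = c}) / real (card B) + \<eta>)"
    unfolding ev[OF assms(1,4)] using assms(6) by (intro sum_mono) auto
  also have "\<dots> = real (card {x \<in> B. E (cell x)}) / real (card B) + real (card ?C) * \<eta>"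
    unfolding ev[OF assms(2,5)] by (simp add: sum.distrib)
  also have "\<dots> \<le> real (card {x \<in> B. E (cell x)}) / real (card B) + real (card C) * \<eta>"
    using assms(3,7) card_mono[of C ?C] by (intro add_left_mono mult_right_mono) auto
  finally show ?thesis .
qed

section \<open>Lower bounds for the overlap of one tuple\<close>

lemma carrier_Fp: "carrier (Fp p) = {0..<int p}"
  by (auto simp: residue_ring_def)

lemma pmf_form:
  assumes "A \<subseteq> cube n" "A \<noteq> {}" and \<phi>: "\<And>x. x \<in> cube n \<Longrightarrow> \<phi> x = dot n a x mod int p"
    and d: "d \<in> {0..<int p}"
  shows "pmf (map_pmf \<phi> (pmf_of_set A)) d = real (card {x \<in> A. int p dvd dot n a x - d}) / real (card A)"
proof -
  have "finite A" using assms(1) finite_cube finite_subset by blast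
  moreover have "{x \<in> A. \<phi> x = d} = {x \<in> A. int p dvd dot n a x - d}"
  proof (rule Collect_cong, rule conj_cong[OF refl])
    fix x assume "x \<in> A"
    then have "\<phi> x = dot n a x mod int p" using assms(1) \<phi> by blast
    moreover have "d mod int p = d" using d by simp
    ultimately show "\<phi> x = d \<longleftrightarrow> int p dvd dot n a x - d"
      by (metis mod_eq_dvd_iff)
  qed
  ultimately show ?thesis using pmf_map_pmf_of_set[OF _ assms(2), of \<phi> d] by (simp only:)
qed

text \<open>A single value suffices: one that is popular on the possibly biased set
  \<open>A k0\<close> has mass at least \<open>1 / p\<close> there, and nearly that mass on the
  other, almost uniform sets.\<close>

lemma overlap_ge_if_unbiased:
  assumes "p > 0" and "m \<ge> 1" and A: "\<And>k. k \<in> {1..m} \<Longrightarrow> A k \<subseteq> cube n \<and> A k \<noteq> {}"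
    and \<phi>: "\<And>x. x \<in> cube n \<Longrightarrow> \<phi> x = dot n a x mod int p"
    and k0: "k0 \<in> {1..m}" and unb: "\<And>k. k \<in> {1..m} \<Longrightarrow> k \<noteq> k0 \<Longrightarrow> \<not> biased p n \<eta> (A k) a"
    and "\<eta> \<ge> 0"
  shows "overlap_on (carrier (Fp p)) m A \<phi> \<ge> 1 / real p - \<eta>"
proof -
  have finA: "finite (A k)" if "k \<in> {1..m}" for k
    using A[OF that] finite_cube finite_subset by blast
  obtain z where z: "card (A k0) \<le> p * card {x \<in> A k0. int p dvd dot n a x - dot n a z}"
    using exists_popular_value[OF finA[OF k0], of n p "dot n a"] A[OF k0] assms(1) by blast
  define d where "d = dot n a z mod int p"
  have d: "d \<in> {0..<int p}" using assms(1) by (simp add: d_def)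
  have dz: "int p dvd dot n a x - d \<longleftrightarrow> int p dvd dot n a x - dot n a z" for x
    unfolding d_def mod_eq_dvd_iff[symmetric] by simp
  have "sum (\<lambda>d'. if d' = d then 1 / real p - \<eta> else 0) (carrier (Fp p))
      \<le> overlap (carrier (Fp p)) m (\<lambda>k. map_pmf \<phi> (pmf_of_set (A k)))"
  proof (rule overlap_ge[OF assms(2)])
    fix d' k assume k: "k \<in> {1..m}"
    have "1 / real p - \<eta> \<le> pmf (map_pmf \<phi> (pmf_of_set (A k))) d"
    proof (cases "k = k0")
      case True
      have pos: "real (card (A k0)) > 0" using A[OF k0] finA[OF k0] by (simp add: card_gt_0_iff)
      have "real (card (A k0)) \<le> real p * real (card {x \<in> A k0. int p dvd dot n a x - d})"
        using z unfolding dz by (simp only: of_nat_mult[symmetric] of_nat_le_iff)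
      then have "1 / real p \<le> real (card {x \<in> A k0. int p dvd dot n a x - d}) / real (card (A k0))"
        using pos assms(1) by (simp add: field_simps)
      then show ?thesis
        using True pmf_form[OF conjunct1[OF A[OF k0]] conjunct2[OF A[OF k0]] \<phi> d] assms(7) by simp
    next
      case False
      have "A k \<noteq> {}" using A[OF k] by simp
      from unbiased_near_uniform[OF assms(1) finA[OF k] this unb[OF k False] assms(7), of d]
      show ?thesis
        using pmf_form[OF conjunct1[OF A[OF k]] conjunct2[OF A[OF k]] \<phi> d] by simp
    qed
    then show "(if d' = d then 1 / real p - \<eta> else 0) \<le> pmf (map_pmf \<phi> (pmf_of_set (A k))) d'"
      by simp
  qed
  then show ?thesis
    using d unfolding overlap_on_def carrier_Fp by simp
qed

text \<open>The law of the common target has total mass one on \<open>A 1\<close> and is dominated,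
  up to \<open>\<eta>'\<close>, by its law on every \<open>A k\<close>, since the target depends
  only on \<open>h x\<close> and the bits in \<open>J0\<close>. The form inherits this law up to the
  factor \<open>p * 2 ^ (p - 1)\<close>, so the main term does not deteriorate with
  \<open>m\<close>.\<close>

lemma overlap_ge_if_near_common_form:
  fixes h :: "(nat \<Rightarrow> int) \<Rightarrow> 'c" and g :: "'c \<Rightarrow> int" and \<eta> \<eta>' :: real
  assumes p: "p > 0" and m: "m \<ge> 1" and A: "\<And>k. k \<in> {1..m} \<Longrightarrow> A k \<subseteq> cube n \<and> A k \<noteq> {}"
    and \<phi>: "\<And>x. x \<in> cube n \<Longrightarrow> \<phi> x = dot n a x mod int p"
    and g: "\<And>x. g (h x) = dot n v x mod int p" and v: "hamming p n a v \<le> L"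
    and J: "\<And>k. k \<in> {1..m} \<Longrightarrow> J0 \<subseteq> J k" "\<And>k. k \<in> {1..m} \<Longrightarrow> J k \<subseteq> {1..n}"
      "\<And>k l. k \<in> {1..m} \<Longrightarrow> l \<in> {1..m} \<Longrightarrow> k \<noteq> l \<Longrightarrow> J k \<inter> J l \<subseteq> J0"
    and resample: "\<And>k S E. k \<in> {1..m} \<Longrightarrow> S \<subseteq> {1..n} \<Longrightarrow> S \<inter> J k = {} \<Longrightarrow> card S \<le> L \<Longrightarrow>
      (\<Sum>x\<in>A k. real (card {z \<in> S \<rightarrow>\<^sub>E {0, 1}. E (h x) (restrict x (J k)) z}) / 2 ^ card S)
      \<le> real (card {x \<in> A k. E (h x) (restrict x (J k)) (restrict x S)}) + \<eta> * real (card (A k))"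
    and similar: "\<And>k E. k \<in> {1..m} \<Longrightarrow>
      real (card {x \<in> A 1. E (h x) (restrict x J0)}) / real (card (A 1))
      \<le> real (card {x \<in> A k. E (h x) (restrict x J0)}) / real (card (A k)) + \<eta>'"
    and \<eta>': "\<eta>' \<ge> 0"
  shows "overlap_on (carrier (Fp p)) m A \<phi> \<ge> 1 / (real p * 2 ^ (p - 1)) - real p * \<eta> - \<eta>'"
proof -
  let ?\<beta> = "real p * 2 ^ (p - 1)"
  have \<beta>: "?\<beta> > 0" using p by simp
  have finA: "finite (A k)" and posA: "real (card (A k)) > 0" if "k \<in> {1..m}" for k
  proof -
    show "finite (A k)" using A[OF that] finite_cube finite_subset by blast
    then show "real (card (A k)) > 0" using A[OF that] by (simp add: card_gt_0_iff)
  qed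
  define b where "b j = a j - v j" for j
  have supp: "card {j \<in> {1..n}. \<not> int p dvd b j} \<le> L"
    using v by (simp add: hamming_def b_def)
  have "\<exists>T. (\<forall>c y. T c y \<in> {0..<int p}) \<and>
    (\<forall>k\<in>{1..m}. \<forall>d. real (card {x \<in> A k. T (h x) (restrict x J0) = d}) \<le> ?\<beta> *
        (real (card {x \<in> A k. int p dvd g (h x) + dot n b x - d}) + \<eta> * real (card (A k))))"
    by (rule common_target[OF p finite_atLeastAtMost _ J supp resample, where g = g])
       (use A in auto)
  then obtain T where T: "\<And>c y. T c y \<in> {0..<int p}" and
    T_le: "\<And>k d. k \<in> {1..m} \<Longrightarrow> real (card {x \<in> A k. T (h x) (restrict x J0) = d}) \<le> ?\<beta> *
        (real (card {x \<in> A k. int p dvd g (h x) + dot n b x - d}) + \<eta> * real (card (A k)))"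
    by blast
  have shift: "int p dvd g (h x) + dot n b x - d \<longleftrightarrow> int p dvd dot n a x - d" for x d
  proof -
    have "dot n a x = dot n v x + dot n b x"
      unfolding dot_def b_def sum.distrib[symmetric] by (simp add: algebra_simps)
    then show ?thesis
      unfolding g mod_eq_dvd_iff[symmetric] by (simp add: mod_add_left_eq)
  qed
  define q where "q k d = real (card {x \<in> A k. T (h x) (restrict x J0) = d}) / real (card (A k))" for k d
  have one: "1 \<in> {1..m}" using m by simp
  have "sum (\<lambda>d. (q 1 d - \<eta>') / ?\<beta> - \<eta>) (carrier (Fp p))
      \<le> overlap (carrier (Fp p)) m (\<lambda>k. map_pmf \<phi> (pmf_of_set (A k)))"
  proof (rule overlap_ge[OF m])
    fix d k assume "d \<in> carrier (Fp p)" and k: "k \<in> {1..m}"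
    then have d: "d \<in> {0..<int p}" unfolding carrier_Fp by simp
    let ?P = "real (card {x \<in> A k. int p dvd dot n a x - d}) / real (card (A k))"
    have "q k d \<le> ?\<beta> * (real (card {x \<in> A k. int p dvd dot n a x - d}) + \<eta> * real (card (A k))) / real (card (A k))"
      using T_le[OF k, of d] unfolding shift q_def by (intro divide_right_mono) auto
    also have "\<dots> = ?\<beta> * (?P + \<eta>)"
      using posA[OF k] by (simp add: field_simps)
    finally have "q 1 d - \<eta>' \<le> ?\<beta> * (?P + \<eta>)"
      using similar[OF k, of "\<lambda>c y. T c y = d"] by (simp add: q_def)
    then have "(q 1 d - \<eta>') / ?\<beta> \<le> ?P + \<eta>"
      using \<beta> by (simp add: pos_divide_le_eq mult.commute)
    then show "(q 1 d - \<eta>') / ?\<beta> - \<eta> \<le> pmf (map_pmf \<phi> (pmf_of_set (A k))) d"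
      using pmf_form[OF conjunct1[OF A[OF k]] conjunct2[OF A[OF k]] \<phi> d] by simp
  qed
  moreover have "sum (\<lambda>d. (q 1 d - \<eta>') / ?\<beta> - \<eta>) (carrier (Fp p)) = 1 / ?\<beta> - real p * \<eta>' / ?\<beta> - real p * \<eta>"
  proof -
    have "card (A 1) = (\<Sum>d\<in>{0..<int p}. card {x. x \<in> A 1 \<and> T (h x) (restrict x J0) = d})"
      by (rule card_eq_sum_fibres) (use finA[OF one] T in auto)
    then have "(\<Sum>d\<in>{0..<int p}. q 1 d) = 1"
      using posA[OF one] unfolding q_def sum_divide_distrib[symmetric] of_nat_sum[symmetric] by simp
    then show ?thesis
      unfolding carrier_Fp by (simp add: sum_subtractf diff_divide_distrib flip: sum_divide_distrib)
  qed
  moreover have "real p * \<eta>' / ?\<beta> \<le> \<eta>'"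
  proof -
    have "\<eta>' / 2 ^ (p - 1) \<le> \<eta>' / 1" using \<eta>' by (intro divide_left_mono) auto
    then show ?thesis using p by simp
  qed
  ultimately show ?thesis unfolding overlap_on_def by linarith
qed

section \<open>Numerical bounds and assembly\<close>

lemma le_two_power_pred: "p \<le> 2 ^ (p - 1)" for p :: nat
  by (cases p) (simp_all add: Suc_le_eq less_exp)

lemma overlap_constant_le:
  assumes "prime p" and "m \<ge> 2"
  shows "1 / 2 ^ ((m + 1) * (p - 1)) \<le> 1 / (real p * 2 ^ (p - 1))" (is ?A)
    and "1 / 2 ^ ((m + 1) * (p - 1)) \<le> 1 / real p" (is ?B)
proof -
  have p: "p > 0" using assms(1) by (simp add: prime_gt_0_nat)
  have "real p \<le> real (2 ^ (p - 1))" using le_two_power_pred of_nat_le_iff by blast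
  then have "real p * 2 ^ (p - 1) \<le> 2 ^ (p - 1) * 2 ^ (p - 1)" by simp
  also have "\<dots> = 2 ^ (2 * (p - 1))" by (simp add: mult_2 power_add)
  also have "\<dots> \<le> (2::real) ^ ((m + 1) * (p - 1))"
    using assms(2) by (intro power_increasing mult_right_mono) auto
  finally show A: ?A using p by (intro divide_left_mono) auto
  have "real p * 1 \<le> real p * 2 ^ (p - 1)" by (intro mult_left_mono) auto
  then have "1 / (real p * 2 ^ (p - 1)) \<le> 1 / real p" using p by (intro divide_left_mono) auto
  with A show ?B by linarith
qed

text \<open>When a family shrinks by a factor \<open>W\<close>, the proportion of bad pairs may grow
  by \<open>W\<^sup>2\<close>; \<open>g\<close> is small enough to compensate. The cap at 1 makes
  powers of \<open>g\<close> decrease, and \<open>k + 1\<close> avoids division by zero.\<close>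

lemma small_factor_bounds:
  fixes \<theta> W k :: real
  assumes "\<theta> > 0" "W > 0" "k \<ge> 0"
  defines "g \<equiv> min 1 (\<theta> / ((k + 1) * W\<^sup>2))"
  shows "0 < g" "g \<le> 1" "k * g * W\<^sup>2 \<le> \<theta>"
proof -
  have "k * g * W\<^sup>2 \<le> (k + 1) * (\<theta> / ((k + 1) * W\<^sup>2)) * W\<^sup>2"
    unfolding g_def using assms(1-3) by (intro mult_right_mono mult_mono) auto
  also have "\<dots> = \<theta>" using assms(2,3) by simp
  finally show "k * g * W\<^sup>2 \<le> \<theta>" .
qed (use assms in auto)

theorem mainTheorem2:
  fixes p m :: nat and \<delta> \<nu> \<epsilon> :: real
  assumes "prime p" and "m \<ge> 2" and "\<delta> > 0" and "\<nu> > 0" and "\<epsilon> > 0"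
  shows "\<exists>c::real. c > 0 \<and>
    (\<forall>(n::nat) (s::nat) (\<A> :: nat \<Rightarrow> (nat \<Rightarrow> int) set).
       s > 0 \<longrightarrow>
       (\<forall>i\<in>{1..s}. \<A> i \<subseteq> cube n \<and> \<A> i \<noteq> {} \<and> cube_density n (\<A> i) \<ge> \<delta>) \<longrightarrow>
       (\<exists>Q. Q \<subseteq> {1..s} \<and> real (card Q) \<ge> c * real s \<and>
          real (card {t \<in> {1..m} \<rightarrow>\<^sub>E Q.
                  \<forall>\<phi>. mod_form p n \<phi> \<longrightarrow>
                    overlap_on (carrier (Fp p)) m (\<lambda>j. \<A> (t j)) \<phi>
                      \<ge> 1 / 2 ^ ((m + 1) * (p - 1)) - \<nu>})
            \<ge> (1 - \<epsilon>) * real (card Q) ^ m))"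
proof -
  have p: "p > 0" "p > 1" using prime_gt_0_nat[OF assms(1)] prime_gt_1_nat[OF assms(1)] by simp_all
  obtain \<rho> where \<rho>: "0 < \<rho>" "\<rho> < 1" "\<And>r. \<not> int p dvd r \<Longrightarrow> norm (1 + chr p r) \<le> 2 * \<rho>"
    using norm_one_plus_chr_bound[OF p(1)] by blast
  have "0 < \<delta> * \<nu>\<^sup>2 / 2" using assms by simp
  \<comment> \<open>Forms at distance at least \<open>D\<close> have almost orthogonal characters at
    bias threshold \<open>\<nu>\<close>, and \<open>K\<close> will bound the families of such forms
    biased on one set.\<close>
  then obtain D where D: "\<rho> ^ D < \<delta> * \<nu>\<^sup>2 / 2"
    using real_arch_pow_inv[OF _ \<rho>(2)] by blast
  obtain K :: nat where K: "real p * (2 / (\<delta> * \<nu>\<^sup>2)) \<le> real K" using real_arch_simple by blast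
  \<comment> \<open>\<open>4 * D\<close> is the distance to \<open>V\<close> allowed by the centres;
    the extra 1 keeps \<open>L\<close> positive when \<open>D = 0\<close>.\<close>
  define L where "L = 4 * D + 1"
  define N where "N = p ^ K"
  \<comment> \<open>Half of \<open>\<nu>\<close> pays for resampling, summed over \<open>p\<close>
    target values; the grid size \<open>r\<close> below makes the other half pay for the differences
    between cell laws.\<close>
  define \<eta> where "\<eta> = \<nu> / (2 * real p)"
  have \<eta>: "\<eta> > 0" "real p * \<eta> = \<nu> / 2" using assms p by (auto simp: \<eta>_def)
  obtain C :: nat where C: "real N * real L / (\<delta> * \<eta>\<^sup>2) \<le> real C" using real_arch_simple by blast
  obtain r' :: nat where r': "real (N * 2 ^ C) * 2 / \<nu> \<le> real r'" using real_arch_simple by blast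
  define r where "r = Suc r'"
  have "real (N * 2 ^ C) * 2 / \<nu> \<le> real r" using r' by (simp add: r_def)
  then have r: "r > 0" "real (N * 2 ^ C) * (1 / real r) \<le> \<nu> / 2"
    using assms by (auto simp: r_def field_simps)
  define W where "W = (r + 1) ^ (N * 2 ^ C)"
  have W: "real W > 0" by (simp add: W_def)
  \<comment> \<open>Two kinds of bad pairs, each a proportion \<open>\<theta>\<close> of all pairs,
    over at most \<open>m ^ 2\<close> pairs of positions, cost \<open>\<epsilon>\<close> in
    total.\<close>
  define \<theta> where "\<theta> = \<epsilon> / (2 * (real m)\<^sup>2)"
  have \<theta>: "\<theta> > 0" "(real m)\<^sup>2 * (2 * \<theta>) = \<epsilon>" using assms by (auto simp: \<theta>_def)
  \<comment> \<open>Constants are fixed from the last refinement back to the first: \<open>W\<close>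
    bounds the loss from \<open>Q2\<close> to \<open>Q\<close> and \<open>W1\<close> that from
    \<open>Q1\<close> to \<open>Q\<close>, so pairs bad in \<open>Q2\<close> or \<open>Q1\<close>
    stay few relative to \<open>Q\<close>.\<close>
  define \<gamma>2 where "\<gamma>2 = min 1 (\<theta> / ((real C + 1) * (real W)\<^sup>2))"
  have \<gamma>2: "0 < \<gamma>2" "\<gamma>2 \<le> 1" "real C * \<gamma>2 * (real W)\<^sup>2 \<le> \<theta>"
    using small_factor_bounds[of \<theta> "real W" "real C"] \<theta>(1) W unfolding \<gamma>2_def by auto
  define W1 where "W1 = real W / \<gamma>2 ^ C"
  have W1: "W1 > 0" using W \<gamma>2 by (simp add: W1_def)
  define \<gamma>1 where "\<gamma>1 = min 1 (\<theta> / ((real K + 1) * W1\<^sup>2))"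
  have \<gamma>1: "0 < \<gamma>1" "\<gamma>1 \<le> 1" "real K * \<gamma>1 * W1\<^sup>2 \<le> \<theta>"
    using small_factor_bounds[of \<theta> W1 "real K"] \<theta>(1) W1 unfolding \<gamma>1_def by auto
  define c where "c = \<gamma>1 ^ K / W1"
  have "c > 0" using \<gamma>1 W1 by (simp add: c_def)
  moreover have "\<exists>Q. Q \<subseteq> {1..s} \<and> real (card Q) \<ge> c * real s \<and>
          real (card {t \<in> {1..m} \<rightarrow>\<^sub>E Q.
                  \<forall>\<phi>. mod_form p n \<phi> \<longrightarrow>
                    overlap_on (carrier (Fp p)) m (\<lambda>j. \<A> (t j)) \<phi>
                      \<ge> 1 / 2 ^ ((m + 1) * (p - 1)) - \<nu>})
            \<ge> (1 - \<epsilon>) * real (card Q) ^ m"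
    if s: "s > 0" and dens: "\<forall>i\<in>{1..s}. \<A> i \<subseteq> cube n \<and> \<A> i \<noteq> {} \<and> cube_density n (\<A> i) \<ge> \<delta>"
    for n s :: nat and \<A> :: "nat \<Rightarrow> (nat \<Rightarrow> int) set"
  proof -
    have A: "\<A> i \<subseteq> cube n" "\<A> i \<noteq> {}" "real (card (\<A> i)) \<ge> \<delta> * 2 ^ n" if "i \<in> {1..s}" for i
      using dens that by (auto simp: cube_density_def pos_le_divide_eq)
    interpret forms: finite_packing "hamming p n" "\<lambda>i. {a. biased p n \<nu> (\<A> i) a}" "{1..s}" D K
    proof
      show "card U \<le> K" if "i \<in> {1..s}" "finite U" "U \<subseteq> {a. biased p n \<nu> (\<A> i) a}"
        "\<And>x y. x \<in> U \<Longrightarrow> y \<in> U \<Longrightarrow> x \<noteq> y \<Longrightarrow> D \<le> hamming p n x y" for i U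
      proof -
        have "real (card U) \<le> real p * (2 / (\<delta> * \<nu>\<^sup>2))"
          by (rule card_separated_biased_le[OF assms(1) \<rho> assms(3,4) less_imp_le[OF D] A[OF that(1)] that(2) _ that(4)])
             (use that(3) in auto)
        then show ?thesis using K by linarith
      qed
    qed (rule hamming_refl hamming_commute hamming_triangle finite_atLeastAtMost)+
    have "{1..s} \<noteq> {}" using s by simp
    from forms.common_centres[OF this \<gamma>1(1)]
    obtain V Q1 where V: "finite V" "card V \<le> K" and Q1: "Q1 \<subseteq> {1..s}"
        "real (card Q1) \<ge> \<gamma>1 ^ card V * real (card {1..s})"
        "\<forall>v\<in>V. \<forall>i\<in>Q1. \<exists>b\<in>{a. biased p n \<nu> (\<A> i) a}. hamming p n v b \<le> D"
      and bad1: "real (card {(i, j) \<in> Q1 \<times> Q1. \<exists>x \<in> {a. biased p n \<nu> (\<A> i) a} \<inter> {a. biased p n \<nu> (\<A> j) a}.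
        \<forall>v\<in>V. 4 * D < hamming p n x v}) \<le> K * \<gamma>1 * (real (card Q1))\<^sup>2"
      by (elim exE conjE) (rule that)
    define bad_forms where "bad_forms = {(i, j) \<in> Q1 \<times> Q1.
      \<exists>x \<in> {a. biased p n \<nu> (\<A> i) a} \<inter> {a. biased p n \<nu> (\<A> j) a}. \<forall>v\<in>V. 4 * D < hamming p n x v}"
    have finQ1: "finite Q1" using Q1(1) finite_subset by blast
    have "\<gamma>1 ^ K * real s \<le> \<gamma>1 ^ card V * real s"
      using V \<gamma>1 by (intro mult_right_mono power_decreasing) auto
    then have Q1s: "\<gamma>1 ^ K * real s \<le> real (card Q1)" using Q1(2) by simp
    moreover have "0 < \<gamma>1 ^ K * real s" using \<gamma>1 s by simp
    ultimately have "0 < real (card Q1)" by linarith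
    then have "Q1 \<noteq> {}" by auto

    \<comment> \<open>The joint values of the common forms. A form close to some member of
      \<open>V\<close> is then a function of \<open>h x\<close> plus a form of bounded
      support.\<close>
    define h where "h x = (\<lambda>v\<in>V. dot n v x mod int p)" for x
    define H where "H = (V \<rightarrow>\<^sub>E {0..<int p})"
    have H: "finite H" "card H \<le> N" "h x \<in> H" for x
    proof -
      show "finite H" unfolding H_def using V(1) by (intro finite_PiE) auto
      have "card H = p ^ card V" using V(1) by (simp add: H_def card_funcsetE)
      also have "\<dots> \<le> N" unfolding N_def using V(2) p by (intro power_increasing) auto
      finally show "card H \<le> N" .
      show "h x \<in> H" unfolding h_def H_def restrict_PiE_iff using p by simp
    qed
    define sat where "sat i J \<longleftrightarrow> J \<subseteq> {1..n} \<and> real (card J) \<le> real N * real L / (\<delta> * \<eta>\<^sup>2) \<and>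
      (\<forall>S E. S \<subseteq> {1..n} \<longrightarrow> S \<inter> J = {} \<longrightarrow> card S \<le> L \<longrightarrow>
        (\<Sum>x\<in>\<A> i. real (card {z \<in> S \<rightarrow>\<^sub>E {0, 1}. E (h x) (restrict x J) z}) / 2 ^ card S)
        \<le> real (card {x \<in> \<A> i. E (h x) (restrict x J) (restrict x S)}) + \<eta> * real (card (\<A> i)))" for i J
    have "\<exists>J. sat i J" if "i \<in> Q1" for i
    proof -
      have i: "i \<in> {1..s}" using that Q1(1) by blast
      have hH: "h ` \<A> i \<subseteq> H" using H(3) by blast
      have pos: "N > 0" "L > 0" using p by (simp_all add: N_def L_def)
      show ?thesis
        unfolding sat_def
        by (rule exists_saturated_coordinates[OF A[OF i] assms(3) H(1) hH H(2) pos \<eta>(1)])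
    qed
    then have "\<forall>i\<in>Q1. \<exists>J. sat i J" by blast
    from bchoice[OF this] obtain J where "\<forall>i\<in>Q1. sat i (J i)" by (elim exE)
    note J = bspec[OF this]
    have J_sub: "J i \<subseteq> {1..n}" and J_card: "card (J i) \<le> C" and J_fin: "finite (J i)" if "i \<in> Q1" for i
    proof -
      show sub: "J i \<subseteq> {1..n}" using J[OF that] by (simp add: sat_def)
      then show "finite (J i)" using finite_subset by blast
      have "real (card (J i)) \<le> real C" using J[OF that] C unfolding sat_def by linarith
      then show "card (J i) \<le> C" by simp
    qed
    \<comment> \<open>In the discrete metric with radius 0, near means equal, so the common centres
      form a set \<open>J0\<close> contained in all remaining \<open>J i\<close>, and a pair is bad
      when \<open>J i\<close> and \<open>J j\<close> meet outside \<open>J0\<close>. The packing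
      bound is just \<open>card (J i) \<le> C\<close>.\<close>
    interpret coords: finite_packing "\<lambda>x y. if x = y then 0 else 1" J Q1 0 C
    proof
      show "card U \<le> C" if "i \<in> Q1" "U \<subseteq> J i" for i U
        using card_mono[OF J_fin[OF that(1)] that(2)] J_card[OF that(1)] by linarith
    qed (use finQ1 in auto)
    from coords.common_centres[OF \<open>Q1 \<noteq> {}\<close> \<gamma>2(1)]
    obtain J0 Q2 where J0: "finite J0" "card J0 \<le> C" and Q2: "Q2 \<subseteq> Q1"
        "real (card Q2) \<ge> \<gamma>2 ^ card J0 * real (card Q1)"
        "\<forall>v\<in>J0. \<forall>i\<in>Q2. \<exists>b\<in>J i. (if v = b then 0 else 1) \<le> (0::nat)"
      and bad2: "real (card {(i, j) \<in> Q2 \<times> Q2. \<exists>x \<in> J i \<inter> J j. \<forall>v\<in>J0. 4 * 0 < (if x = v then 0 else 1::nat)})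
        \<le> C * \<gamma>2 * (real (card Q2))\<^sup>2"
      by (elim exE conjE) (rule that)
    define bad_coords where "bad_coords = {(i, j) \<in> Q2 \<times> Q2. \<exists>x \<in> J i \<inter> J j. \<forall>v\<in>J0. 4 * 0 < (if x = v then 0 else 1::nat)}"
    have J0_sub: "J0 \<subseteq> J i" if "i \<in> Q2" for i
    proof
      fix v assume "v \<in> J0"
      from bspec[OF bspec[OF Q2(3) this] that]
      obtain b where "b \<in> J i" "(if v = b then 0 else 1) \<le> (0::nat)" by (elim bexE)
      then show "v \<in> J i" by (cases "v = b") auto
    qed
    have finQ2: "finite Q2" using Q2(1) finQ1 finite_subset by blast
    have "\<gamma>2 ^ C * real (card Q1) \<le> \<gamma>2 ^ card J0 * real (card Q1)"
      using J0 \<gamma>2 by (intro mult_right_mono power_decreasing) auto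
    then have Q2Q1: "\<gamma>2 ^ C * real (card Q1) \<le> real (card Q2)" using Q2(2) by simp
    have "0 < \<gamma>2 ^ C * real (card Q1)"
      using \<gamma>2 \<open>Q1 \<noteq> {}\<close> finQ1 by (simp add: card_gt_0_iff)
    then have "0 < real (card Q2)" using Q2Q1 by linarith
    then have "Q2 \<noteq> {}" by auto
    then have J0n: "J0 \<subseteq> {1..n}" using J0_sub J_sub Q2(1) by blast

    \<comment> \<open>Third refinement: the joint law of \<open>h\<close> and the bits in
      \<open>J0\<close> is made almost the same on all remaining sets.\<close>
    define cell where "cell x = (h x, restrict x J0)" for x
    define cells where "cells = H \<times> (J0 \<rightarrow>\<^sub>E {0::int, 1})"
    have fin_cells: "finite cells" unfolding cells_def using H(1) finite_bits[OF J0(1)] by simp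
    have "card cells = card H * 2 ^ card J0"
      by (simp add: cells_def card_cartesian_product card_bits[OF J0(1)])
    also have "\<dots> \<le> N * 2 ^ C"
      using H(2) J0(2) by (intro mult_mono power_increasing) auto
    finally have card_cells: "card cells \<le> N * 2 ^ C" .
    have in_cells: "cell ` \<A> i \<subseteq> cells" if "i \<in> {1..s}" for i
      unfolding cell_def cells_def using A(1)[OF that] H(3) restrict_cube[OF _ J0n] by blast
    define law where "law i c = real (card {x \<in> \<A> i. cell x = c}) / real (card (\<A> i))" for i c
    have finA: "finite (\<A> i)" if "i \<in> {1..s}" for i
      using A(1)[OF that] finite_cube finite_subset by blast
    have law01: "0 \<le> law i c \<and> law i c \<le> 1" if "i \<in> Q2" for i c
    proof -
      have "i \<in> {1..s}" using that Q2(1) Q1(1) by blast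
      then have "card {x \<in> \<A> i. cell x = c} \<le> card (\<A> i)" using finA by (intro card_mono) auto
      then show ?thesis unfolding law_def by (simp add: divide_le_eq)
    qed
    have "\<exists>Q\<subseteq>Q2. card Q2 \<le> card Q * (r + 1) ^ card cells \<and>
        (\<forall>i\<in>Q. \<forall>j\<in>Q. \<forall>c\<in>cells. law i c \<le> law j c + 1 / real r)"
      by (rule exists_similar_subfamily[OF finQ2 fin_cells _ r(1)]) (rule law01)
    then obtain Q where Q: "Q \<subseteq> Q2" "card Q2 \<le> card Q * (r + 1) ^ card cells"
      and sim: "\<forall>i\<in>Q. \<forall>j\<in>Q. \<forall>c\<in>cells. law i c \<le> law j c + 1 / real r"
      by (elim exE conjE) (rule that)
    have finQ: "finite Q" using Q(1) finQ2 finite_subset by blast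
    have Qs: "Q \<subseteq> {1..s}" using Q(1) Q2(1) Q1(1) by blast
    have "card Q * (r + 1) ^ card cells \<le> card Q * W"
      unfolding W_def using card_cells by (intro mult_left_mono power_increasing) auto
    then have "card Q2 \<le> card Q * W" using Q(2) by linarith
    then have Q2Q: "real (card Q2) \<le> real W * real (card Q)"
      by (simp only: of_nat_mult[symmetric] of_nat_le_iff mult.commute)
    have Q1Q: "real (card Q1) \<le> W1 * real (card Q)"
      using order_trans[OF Q2Q1 Q2Q] \<gamma>2 unfolding W1_def by (simp add: field_simps)
    have "\<gamma>1 ^ K * real s \<le> W1 * real (card Q)" using Q1s Q1Q by linarith
    then have sizeQ: "c * real s \<le> real (card Q)"
      using W1 unfolding c_def by (simp add: field_simps)

    define bad where "bad = (bad_forms \<union> bad_coords) \<inter> Q \<times> Q"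
    have fin_bad: "finite (bad_forms \<union> bad_coords)"
      by (rule finite_subset[of _ "(Q1 \<times> Q1) \<union> (Q2 \<times> Q2)"])
         (use finQ1 finQ2 in \<open>auto simp: bad_forms_def bad_coords_def\<close>)
    have "card bad \<le> card (bad_forms \<union> bad_coords)"
      unfolding bad_def using fin_bad by (intro card_mono) auto
    also have "\<dots> \<le> card bad_forms + card bad_coords" by (rule card_Un_le)
    finally have "real (card bad) \<le> real (card bad_forms) + real (card bad_coords)"
      by (simp only: of_nat_add[symmetric] of_nat_le_iff)
    also have "\<dots> \<le> \<theta> * (real (card Q))\<^sup>2 + \<theta> * (real (card Q))\<^sup>2"
    proof (rule add_mono)
      have "real (card bad_forms) \<le> real K * \<gamma>1 * (real (card Q1))\<^sup>2"
        using bad1 unfolding bad_forms_def .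
      also have "\<dots> \<le> real K * \<gamma>1 * (W1 * real (card Q))\<^sup>2"
        using Q1Q \<gamma>1(1) by (intro mult_left_mono power_mono) auto
      also have "\<dots> = (real K * \<gamma>1 * W1\<^sup>2) * (real (card Q))\<^sup>2" by (simp add: power_mult_distrib)
      also have "\<dots> \<le> \<theta> * (real (card Q))\<^sup>2" using \<gamma>1(3) by (intro mult_right_mono) auto
      finally show "real (card bad_forms) \<le> \<theta> * (real (card Q))\<^sup>2" .
      have "real (card bad_coords) \<le> real C * \<gamma>2 * (real (card Q2))\<^sup>2"
        using bad2 unfolding bad_coords_def .
      also have "\<dots> \<le> real C * \<gamma>2 * (real W * real (card Q))\<^sup>2"
        using Q2Q \<gamma>2(1) by (intro mult_left_mono power_mono) auto
      also have "\<dots> = (real C * \<gamma>2 * (real W)\<^sup>2) * (real (card Q))\<^sup>2" by (simp add: power_mult_distrib)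
      also have "\<dots> \<le> \<theta> * (real (card Q))\<^sup>2" using \<gamma>2(3) by (intro mult_right_mono) auto
      finally show "real (card bad_coords) \<le> \<theta> * (real (card Q))\<^sup>2" .
    qed
    finally have few_bad: "real (card bad) \<le> (2 * \<theta>) * (real (card Q))\<^sup>2" by simp

    have good: "overlap_on (carrier (Fp p)) m (\<lambda>j. \<A> (t j)) \<phi> \<ge> 1 / 2 ^ ((m + 1) * (p - 1)) - \<nu>"
      if t: "t \<in> {1..m} \<rightarrow>\<^sub>E Q"
        and ok: "\<And>k l. k \<in> {1..m} \<Longrightarrow> l \<in> {1..m} \<Longrightarrow> k \<noteq> l \<Longrightarrow> (t k, t l) \<notin> bad"
        and form: "mod_form p n \<phi>" for t \<phi>
    proof -
      have tQ: "t k \<in> Q" if "k \<in> {1..m}" for k using PiE_mem[OF t that] .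
      have tQ2: "t k \<in> Q2" and tQ1: "t k \<in> Q1" and ts: "t k \<in> {1..s}" if "k \<in> {1..m}" for k
        using tQ[OF that] Q(1) Q2(1) Q1(1) by blast+
      have tA: "\<A> (t k) \<subseteq> cube n \<and> \<A> (t k) \<noteq> {}" if "k \<in> {1..m}" for k
        using A(1,2)[OF ts[OF that]] by simp
      have m: "m \<ge> 1" "1 \<in> {1..m}" using assms(2) by auto
      obtain a where a: "\<And>x. x \<in> cube n \<Longrightarrow> \<phi> x = dot n a x mod int p"
        using mod_form_eq_dot[OF p(2) form] by blast
      show ?thesis
      \<comment> \<open>A form biased at two positions must be close to a member of
        \<open>V\<close>, because that pair is not bad; otherwise at most one position is
        biased.\<close>
      proof (cases "\<exists>k\<in>{1..m}. \<exists>l\<in>{1..m}. k \<noteq> l \<and> biased p n \<nu> (\<A> (t k)) a \<and> biased p n \<nu> (\<A> (t l)) a")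
        case True
        then obtain k l where kl: "k \<in> {1..m}" "l \<in> {1..m}" "k \<noteq> l"
          "biased p n \<nu> (\<A> (t k)) a" "biased p n \<nu> (\<A> (t l)) a" by blast
        have "(t k, t l) \<notin> bad_forms"
          using ok[OF kl(1-3)] tQ kl(1,2) by (simp add: bad_def)
        then have "\<not> (\<forall>v\<in>V. 4 * D < hamming p n a v)"
          using kl(4,5) tQ1[OF kl(1)] tQ1[OF kl(2)] unfolding bad_forms_def by blast
        then obtain v where v: "v \<in> V" "hamming p n a v \<le> L"
          by (auto simp: L_def not_less)
        have "overlap_on (carrier (Fp p)) m (\<lambda>j. \<A> (t j)) \<phi>
            \<ge> 1 / (real p * 2 ^ (p - 1)) - real p * \<eta> - real (card cells) * (1 / real r)"
        proof (rule overlap_ge_if_near_common_form[where a = a and v = v and h = h and g = "\<lambda>c. c v"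
              and A = "\<lambda>k. \<A> (t k)" and \<phi> = \<phi> and ?J0.0 = J0 and J = "\<lambda>k. J (t k)" and L = L, OF p(1) m(1) _ _ _ v(2)])
          show "\<A> (t k) \<subseteq> cube n \<and> \<A> (t k) \<noteq> {}" if "k \<in> {1..m}" for k
            by (rule tA[OF that])
          show "\<phi> x = dot n a x mod int p" if "x \<in> cube n" for x
            by (rule a[OF that])
          show "h x v = dot n v x mod int p" for x using v(1) by (simp add: h_def)
          show "J0 \<subseteq> J (t k)" "J (t k) \<subseteq> {1..n}" if "k \<in> {1..m}" for k
            using J0_sub[OF tQ2[OF that]] J_sub[OF tQ1[OF that]] by auto
          show "J (t k) \<inter> J (t l) \<subseteq> J0" if "k \<in> {1..m}" "l \<in> {1..m}" "k \<noteq> l" for k l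
          proof -
            have "(t k, t l) \<notin> bad_coords"
              using ok[OF that] tQ that(1,2) by (simp add: bad_def)
            then have "\<not> (\<exists>x \<in> J (t k) \<inter> J (t l). \<forall>v\<in>J0. 4 * 0 < (if x = v then 0 else 1::nat))"
              using tQ2[OF that(1)] tQ2[OF that(2)] unfolding bad_coords_def by blast
            moreover have "4 * 0 < (if x = v then 0 else 1::nat)" if "x \<notin> J0" "v \<in> J0" for x v
              using that by (cases "x = v") auto
            ultimately show ?thesis by blast
          qed
          show "(\<Sum>x\<in>\<A> (t k). real (card {z \<in> S \<rightarrow>\<^sub>E {0, 1}. E (h x) (restrict x (J (t k))) z}) / 2 ^ card S)
              \<le> real (card {x \<in> \<A> (t k). E (h x) (restrict x (J (t k))) (restrict x S)}) + \<eta> * real (card (\<A> (t k)))"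
            if "k \<in> {1..m}" "S \<subseteq> {1..n}" "S \<inter> J (t k) = {}" "card S \<le> L" for k S E
            using J[OF tQ1[OF that(1)]] that(2-4) unfolding sat_def by blast
          show "real (card {x \<in> \<A> (t 1). E (h x) (restrict x J0)}) / real (card (\<A> (t 1)))
              \<le> real (card {x \<in> \<A> (t k). E (h x) (restrict x J0)}) / real (card (\<A> (t k)))
                + real (card cells) * (1 / real r)" if "k \<in> {1..m}" for k E
          proof -
            have "law (t 1) c \<le> law (t k) c + 1 / real r" if "c \<in> cells" for c
              using sim tQ[OF m(2)] tQ[OF \<open>k \<in> {1..m}\<close>] that by blast
            then have "real (card {x \<in> \<A> (t 1). (\<lambda>(c, y). E c y) (cell x)}) / real (card (\<A> (t 1)))
              \<le> real (card {x \<in> \<A> (t k). (\<lambda>(c, y). E c y) (cell x)}) / real (card (\<A> (t k)))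
                + real (card cells) * (1 / real r)"
              unfolding law_def
              by (intro similar_laws_events[OF finA[OF ts[OF m(2)]] finA[OF ts[OF that]] fin_cells
                in_cells[OF ts[OF m(2)]] in_cells[OF ts[OF that]]]) auto
            then show ?thesis by (simp add: cell_def)
          qed
        qed simp
        moreover have "real (card cells) * (1 / real r) \<le> \<nu> / 2"
        proof -
          have "real (card cells) * (1 / real r) \<le> real (N * 2 ^ C) * (1 / real r)"
            by (intro mult_right_mono of_nat_mono card_cells) simp
          then show ?thesis using r(2) by linarith
        qed
        ultimately show ?thesis
          using overlap_constant_le(1)[OF assms(1,2)] \<eta>(2) by linarith
      next
        case False
        \<comment> \<open>The only biased position, or position 1 if there is none.\<close>
        obtain k0 where k0: "k0 \<in> {1..m}" "\<And>k. k \<in> {1..m} \<Longrightarrow> k \<noteq> k0 \<Longrightarrow> \<not> biased p n \<nu> (\<A> (t k)) a"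
        proof (cases "\<exists>k\<in>{1..m}. biased p n \<nu> (\<A> (t k)) a")
          case True
          then obtain k1 where "k1 \<in> {1..m}" "biased p n \<nu> (\<A> (t k1)) a" by blast
          then show ?thesis using False by (intro that[of k1]) blast+
        next
          case none: False
          show ?thesis by (rule that[OF m(2)]) (use none in blast)
        qed
        have "overlap_on (carrier (Fp p)) m (\<lambda>j. \<A> (t j)) \<phi> \<ge> 1 / real p - \<nu>"
          by (rule overlap_ge_if_unbiased[where A = "\<lambda>j. \<A> (t j)" and \<phi> = \<phi> and a = a and ?k0.0 = k0, OF p(1) m(1) tA a k0 less_imp_le[OF assms(4)]])
        then show ?thesis using overlap_constant_le(2)[OF assms(1,2)] by linarith
      qed
    qed
    have "real (card {t \<in> {1..m} \<rightarrow>\<^sub>E Q. \<forall>\<phi>. mod_form p n \<phi> \<longrightarrow>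
          overlap_on (carrier (Fp p)) m (\<lambda>j. \<A> (t j)) \<phi> \<ge> 1 / 2 ^ ((m + 1) * (p - 1)) - \<nu>})
        \<ge> (1 - (real m)\<^sup>2 * (2 * \<theta>)) * real (card Q) ^ m"
    proof (rule card_good_tuples_ge[OF finQ assms(2) _ few_bad])
      show "bad \<subseteq> Q \<times> Q" by (simp add: bad_def)
    qed (intro allI impI good)
    then show ?thesis
      unfolding \<theta>(2) using Qs sizeQ by (intro exI[of _ Q] conjI)
  qed
  ultimately show ?thesis by blast
qed

end
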